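(* (Generalised Rice–Shapiro.) Let $(X,\tau,\alpha)$ be a modular $T_0$-space, let $\bar\gamma:\omega\to X_c$ be a principal computable numbering of $X_c$, and let $K\subseteq X_c$. Then the index set $Ix(K)=\{n\mid\bar\gamma(n)\in K\}$ is computably enumerable if and only if $K$ is effectively open in $X_c$, i.e. $K=X_c\cap\bigcup_{n\in W_i}\alpha(n)$ for some $i$. Moreover, such an index $i$ with $K=\bigcup_{n\in W_i}\alpha(n)\cap X_c$ can be computed from a c.e. index of $Ix(K)$.
   Context: $W_e$ denotes the $e$-th c.e. set. A topological space $(X,\tau,\alpha)$ with $\alpha:\omega\to$ (a base of $\tau$) is effectively enumerable if (1) there is a computable $g$ with $\alpha(i)\cap\alpha(j)=\bigcup_{n}\alpha(g(i,j,n))$, and (2) $\{i\mid\alpha(i)\neq\emptyset\}$ is c.e. Effectively open set: $\bigcup_{n\in V}\alpha(n)$ with $V$ c.e.; a sequence $\{\mathcal{O}_n\}$ of such sets is computable if $\mathcal{O}_n=\bigcup_{k\in W_{f(n)}}\alpha(k)$ for a computable $f$. $A_x=\{n\mid x\in\alpha(n)\}$; $x$ is computable if $A_x$ is c.e.; $X_c$ is the set of computable elements; a sequence $\{a_n\}$ of computable elements is computable if $A_{a_n}=W_{f(n)}$ for a computable $f$; $\widehat{X_c}=\{A_a\mid a\in X_c\}$. A family $S$ of c.e. sets is a $wn$-family if there is a partial computable $\sigma$ with (i) $\sigma(n)\downarrow\Rightarrow W_{\sigma(n)}\in S$, (ii) $W_n\in S\Rightarrow n\in\mathrm{dom}(\sigma)$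 and $W_{\sigma(n)}=W_n$. Specialisation order: $x\le y$ iff every open set containing $x$ contains $y$; $x\le\mathcal{O}$ means $x\le y$ for all $y\in\mathcal{O}$. A modular $T_0$-space is an effectively enumerable $T_0$-space such that (Req 1) $\widehat{X_c}$ is a $wn$-family and (Req 2) there are a computable sequence $\{b_n\}$ of computable elements and a computable sequence $\{\mathcal{O}_n\}$ of effectively open sets with $b_n\le\mathcal{O}_n$ for all $n$ and $\alpha(m)=\bigcup_{i\,:\,b_i\in\alpha(m)}\mathcal{O}_i$ for all $m$. A numbering $\gamma:\omega\to X_c$ (surjective) is computable if $\{A_{\gamma(n)}\}_n$ is a computable sequence of c.e. sets, and principal computable if moreover every computable numbering $\xi$ of $X_c$ satisfies $\xi=\gamma\circ f$ for some computable $f$. When $\widehat{X_c}$ is a $wn$-family, a principal computable numbering of $X_c$ exists. *)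

theory Defs
  imports "HOL-Analysis.Abstract_Topological_Spaces" "HOL-Library.Nat_Bijection"
begin

text \<open>
  Programs for the unary partial recursive functions. Functions of several arguments are handled
  through the Cantor pairing function \<^const>\<open>prod_encode\<close>, so composition, primitive recursion and
  minimisation are the usual schemes applied to coded arguments.
\<close>

datatype prog =
    Zero
  | Successor
  | Proj1
  | Proj2
  | Pairing prog prog
  | Comp prog prog
  | PrimRec prog prog
  | Minimise prog

primrec run :: "prog \<Rightarrow> nat \<Rightarrow> nat option" where
  "run Zero = (\<lambda>x. Some 0)"
| "run Successor = (\<lambda>x. Some (Suc x))"
| "run Proj1 = (\<lambda>x. Some (fst (prod_decode x)))"
| "run Proj2 = (\<lambda>x. Some (snd (prod_decode x)))"
| "run (Pairing p q) =
     (\<lambda>x. Option.bind (run p x) (\<lambda>a. Option.bind (run q x) (\<lambda>b. Some (prod_encode (a, b)))))"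
| "run (Comp p q) = (\<lambda>x. Option.bind (run q x) (run p))"
| "run (PrimRec p q) =
     (\<lambda>x. case prod_decode x of (a, n) \<Rightarrow>
        rec_nat (run p a)
          (\<lambda>k r. Option.bind r (\<lambda>v. run q (prod_encode (a, prod_encode (k, v))))) n)"
| "run (Minimise p) =
     (\<lambda>x. if \<exists>n. run p (prod_encode (x, n)) = Some 0 \<and>
                  (\<forall>k<n. \<exists>v. run p (prod_encode (x, k)) = Some (Suc v))
          then Some (LEAST n. run p (prod_encode (x, n)) = Some 0)
          else None)"

text \<open>
  The Goedel numbering: \<open>e\<close> codes a pair of a constructor tag and an argument. Every number codes
  a program (tags above \<open>7\<close> are read as \<open>7\<close>), and every program has a code.
\<close>

function prog_of :: "nat \<Rightarrow> prog" where
  "prog_of e =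
     (let t = fst (prod_decode e); m = snd (prod_decode e);
          a = fst (prod_decode m); b = snd (prod_decode m)
      in if t = 0 then Zero
         else if t = 1 then Successor
         else if t = 2 then Proj1
         else if t = 3 then Proj2
         else if t = 4 then Pairing (prog_of a) (prog_of b)
         else if t = 5 then Comp (prog_of a) (prog_of b)
         else if t = 6 then PrimRec (prog_of a) (prog_of b)
         else Minimise (prog_of m))"
  by pat_completeness auto
termination
proof -
  have snd_less: "snd (prod_decode e) < e" if "fst (prod_decode e) \<noteq> 0" for e
  proof -
    have "e = prod_encode (fst (prod_decode e), snd (prod_decode e))" by simp
    also have "\<dots> = triangle (fst (prod_decode e) + snd (prod_decode e)) + fst (prod_decode e)"
      by (simp only: prod_encode_def split_conv)
    finally have "e = triangle (fst (prod_decode e) + snd (prod_decode e)) + fst (prod_decode e)" .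
    moreover have "n \<le> triangle n" for n by (induction n) auto
    from this[of "fst (prod_decode e) + snd (prod_decode e)"]
    have "fst (prod_decode e) + snd (prod_decode e)
            \<le> triangle (fst (prod_decode e) + snd (prod_decode e))" .
    ultimately show ?thesis using that by linarith
  qed
  have fst_le: "fst (prod_decode m) \<le> m" for m
    by (metis le_prod_encode_1 prod.collapse prod_decode_inverse)
  have snd_le: "snd (prod_decode m) \<le> m" for m
    by (metis le_prod_encode_2 prod.collapse prod_decode_inverse)
  show ?thesis
    by (relation "Wellfounded.measure id")
       (auto intro: snd_less order_le_less_trans[OF fst_le snd_less]
          order_le_less_trans[OF snd_le snd_less])
qed

declare prog_of.simps [simp del]

lemma surj_prog_of: "surj prog_of"
proof -
  have "\<exists>e. prog_of e = p" for p
  proof (induction p)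
    case Zero
    have "prog_of (prod_encode (0, 0)) = Zero" by (subst prog_of.simps) simp
    then show ?case ..
  next
    case Successor
    have "prog_of (prod_encode (1, 0)) = Successor" by (subst prog_of.simps) simp
    then show ?case ..
  next
    case Proj1
    have "prog_of (prod_encode (2, 0)) = Proj1" by (subst prog_of.simps) simp
    then show ?case ..
  next
    case Proj2
    have "prog_of (prod_encode (3, 0)) = Proj2" by (subst prog_of.simps) simp
    then show ?case ..
  next
    case (Pairing p q)
    then obtain a b where "prog_of a = p" "prog_of b = q" by blast
    then have "prog_of (prod_encode (4, prod_encode (a, b))) = Pairing p q"
      by (subst prog_of.simps) simp
    then show ?case ..
  next
    case (Comp p q)
    then obtain a b where "prog_of a = p" "prog_of b = q" by blast
    then have "prog_of (prod_encode (5, prod_encode (a, b))) = Comp p q"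
      by (subst prog_of.simps) simp
    then show ?case ..
  next
    case (PrimRec p q)
    then obtain a b where "prog_of a = p" "prog_of b = q" by blast
    then have "prog_of (prod_encode (6, prod_encode (a, b))) = PrimRec p q"
      by (subst prog_of.simps) simp
    then show ?case ..
  next
    case (Minimise p)
    then obtain a where "prog_of a = p" by blast
    then have "prog_of (prod_encode (7, a)) = Minimise p"
      by (subst prog_of.simps) simp
    then show ?case ..
  qed
  then show ?thesis by (metis surjI)
qed

definition \<phi> :: "nat \<Rightarrow> nat \<Rightarrow> nat option" where
  "\<phi> e = run (prog_of e)"

definition W :: "nat \<Rightarrow> nat set" where
  "W e = dom (\<phi> e)"

definition partial_computable :: "(nat \<Rightarrow> nat option) \<Rightarrow> bool" where
  "partial_computable f \<longleftrightarrow> (\<exists>e. f = \<phi> e)"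

definition computable :: "(nat \<Rightarrow> nat) \<Rightarrow> bool" where
  "computable f \<longleftrightarrow> partial_computable (\<lambda>n. Some (f n))"

definition ce :: "nat set \<Rightarrow> bool" where
  "ce A \<longleftrightarrow> (\<exists>e. A = W e)"

definition computable_ce_sequence :: "(nat \<Rightarrow> nat set) \<Rightarrow> bool" where
  "computable_ce_sequence A \<longleftrightarrow> (\<exists>f. computable f \<and> (\<forall>n. A n = W (f n)))"

definition wn_family :: "nat set set \<Rightarrow> bool" where
  "wn_family S \<longleftrightarrow>
     (\<forall>A\<in>S. ce A) \<and>
     (\<exists>\<sigma>. partial_computable \<sigma> \<and>
        (\<forall>n m. \<sigma> n = Some m \<longrightarrow> W m \<in> S) \<and>
        (\<forall>n. W n \<in> S \<longrightarrow> (\<exists>m. \<sigma> n = Some m \<and> W m = W n)))"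

text \<open>The ternary computable function \<open>g\<close> is given as a unary one on coded triples.\<close>

definition effectively_enumerable :: "'a topology \<Rightarrow> (nat \<Rightarrow> 'a set) \<Rightarrow> bool" where
  "effectively_enumerable X \<alpha> \<longleftrightarrow>
     openin X = arbitrary union_of (\<lambda>U. U \<in> range \<alpha>) \<and>
     (\<exists>g. computable g \<and>
        (\<forall>i j. \<alpha> i \<inter> \<alpha> j = (\<Union>n. \<alpha> (g (prod_encode (i, prod_encode (j, n))))))) \<and>
     ce {i. \<alpha> i \<noteq> {}}"

definition eff_open_set :: "(nat \<Rightarrow> 'a set) \<Rightarrow> nat \<Rightarrow> 'a set" where
  "eff_open_set \<alpha> i = (\<Union>n\<in>W i. \<alpha> n)"

definition computable_eff_open_sequence ::
    "(nat \<Rightarrow> 'a set) \<Rightarrow> (nat \<Rightarrow> 'a set) \<Rightarrow> bool" where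
  "computable_eff_open_sequence \<alpha> \<O> \<longleftrightarrow>
     (\<exists>f. computable f \<and> (\<forall>n. \<O> n = eff_open_set \<alpha> (f n)))"

definition nbhd_indices :: "(nat \<Rightarrow> 'a set) \<Rightarrow> 'a \<Rightarrow> nat set" where
  "nbhd_indices \<alpha> x = {n. x \<in> \<alpha> n}"

definition computable_points :: "'a topology \<Rightarrow> (nat \<Rightarrow> 'a set) \<Rightarrow> 'a set" where
  "computable_points X \<alpha> = {x \<in> topspace X. ce (nbhd_indices \<alpha> x)}"

definition computable_point_sequence ::
    "'a topology \<Rightarrow> (nat \<Rightarrow> 'a set) \<Rightarrow> (nat \<Rightarrow> 'a) \<Rightarrow> bool" where
  "computable_point_sequence X \<alpha> a \<longleftrightarrow>
     (\<forall>n. a n \<in> computable_points X \<alpha>) \<and>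
     computable_ce_sequence (\<lambda>n. nbhd_indices \<alpha> (a n))"

definition spec_le :: "'a topology \<Rightarrow> 'a \<Rightarrow> 'a \<Rightarrow> bool" where
  "spec_le X x y \<longleftrightarrow> (\<forall>U. openin X U \<longrightarrow> x \<in> U \<longrightarrow> y \<in> U)"

definition modular_T0_space :: "'a topology \<Rightarrow> (nat \<Rightarrow> 'a set) \<Rightarrow> bool" where
  "modular_T0_space X \<alpha> \<longleftrightarrow>
     effectively_enumerable X \<alpha> \<and>
     t0_space X \<and>
     wn_family (nbhd_indices \<alpha> ` computable_points X \<alpha>) \<and>
     (\<exists>b \<O>. computable_point_sequence X \<alpha> b \<and>
        computable_eff_open_sequence \<alpha> \<O> \<and>
        (\<forall>n. \<forall>y\<in>\<O> n. spec_le X (b n) y) \<and>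
        (\<forall>m. \<alpha> m = (\<Union>i\<in>{i. b i \<in> \<alpha> m}. \<O> i)))"

definition computable_numbering ::
    "'a topology \<Rightarrow> (nat \<Rightarrow> 'a set) \<Rightarrow> (nat \<Rightarrow> 'a) \<Rightarrow> bool" where
  "computable_numbering X \<alpha> \<gamma> \<longleftrightarrow>
     range \<gamma> = computable_points X \<alpha> \<and>
     computable_ce_sequence (\<lambda>n. nbhd_indices \<alpha> (\<gamma> n))"

definition principal_computable_numbering ::
    "'a topology \<Rightarrow> (nat \<Rightarrow> 'a set) \<Rightarrow> (nat \<Rightarrow> 'a) \<Rightarrow> bool" where
  "principal_computable_numbering X \<alpha> \<gamma> \<longleftrightarrow>
     computable_numbering X \<alpha> \<gamma> \<and>
     (\<forall>\<xi>. computable_numbering X \<alpha> \<xi> \<longrightarrow> (\<exists>f. computable f \<and> \<xi> = \<gamma> \<circ> f))"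

definition Ix :: "(nat \<Rightarrow> 'a) \<Rightarrow> 'a set \<Rightarrow> nat set" where
  "Ix \<gamma> K = {n. \<gamma> n \<in> K}"

end

theory Submission
  imports Defs
begin

text \<open>
  Programs are run by an abstract machine on coded states whose single step is computable; counting
  its steps gives a universal program, the s-m-n theorem and the usual calculus of c.e. sets.

  Requirement 1 turns a c.e. index of some \<open>A\<^sub>x\<close> effectively into a number of \<open>x\<close>: run the
  \<open>wn\<close>-function and enumerate its domain to get a computable numbering, which the principal one
  absorbs. Let \<open>Ix(K)\<close> be c.e. Enumerate into \<open>W\<^bsub>r(n)\<^esub>\<close> the set \<open>A\<^sub>x\<close> as long as the computation of
  program \<open>n\<close> on \<open>n\<close> has not stopped; if stopping forces \<open>W\<^bsub>r(n)\<^esub> = A\<^sub>y\<close> with \<open>x \<in> K\<close>, \<open>y \<notin> K\<close>, then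
  the complement of the halting set is c.e. With \<open>x \<le> y\<close> this shows that \<open>K\<close> is upward closed. With
  \<open>y\<close> the current member of a computable increasing chain of points \<open>b\<^sub>i\<close>, \<open>x \<in> \<O>\<^sub>i\<close>, whose \<open>A\<close> exhaust
  \<open>A\<^sub>x\<close>, it shows that every \<open>x \<in> K\<close> lies in some \<open>\<O>\<^sub>i\<close> with \<open>b\<^sub>i \<in> K\<close>. Hence \<open>K\<close> is the trace on \<open>X\<^sub>c\<close>
  of the union of the \<open>\<O>\<^sub>i\<close> with \<open>b\<^sub>i \<in> K\<close>, and these \<open>i\<close> are enumerable from an index of \<open>Ix(K)\<close>.
\<close>

section \<open>Closure properties of computable functions\<close>

abbreviation pair :: "nat \<Rightarrow> nat \<Rightarrow> nat" where "pair a b \<equiv> prod_encode (a, b)"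
abbreviation pfst :: "nat \<Rightarrow> nat" where "pfst x \<equiv> fst (prod_decode x)"
abbreviation psnd :: "nat \<Rightarrow> nat" where "psnd x \<equiv> snd (prod_decode x)"

lemma pair_pfst_psnd [simp]: "pair (pfst z) (psnd z) = z"
  by simp

lemma partial_computable_iff_run: "partial_computable f \<longleftrightarrow> (\<exists>p. run p = f)"
  unfolding partial_computable_def \<phi>_def by (metis surj_prog_of surjD)

lemma computable_iff_run: "computable f \<longleftrightarrow> (\<exists>p. \<forall>x. run p x = Some (f x))"
  by (auto simp: computable_def partial_computable_iff_run fun_eq_iff)

lemma computable_id: "computable (\<lambda>x. x)"
  \<comment> \<open>Decoding a number and encoding its two parts again is the identity.\<close>
  unfolding computable_iff_run by (rule exI[of _ "Pairing Proj1 Proj2"]) simp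

lemma computable_const: "computable (\<lambda>x. c)"
proof (induction c)
  case 0
  show ?case unfolding computable_iff_run by (rule exI[of _ Zero]) simp
next
  case (Suc c)
  then obtain p where "\<forall>x. run p x = Some c" unfolding computable_iff_run by blast
  then show ?case unfolding computable_iff_run by (intro exI[of _ "Comp Successor p"]) simp
qed

lemma partial_computable_Some: "computable f \<Longrightarrow> partial_computable (\<lambda>x. Some (f x))"
  by (simp add: computable_def)

lemma partial_computable_subst:
  assumes "partial_computable f" "computable g"
  shows "partial_computable (\<lambda>x. f (g x))"
proof -
  obtain p q where "run p = f" "\<forall>x. run q x = Some (g x)"
    using assms unfolding partial_computable_iff_run computable_iff_run by blast
  then show ?thesis
    unfolding partial_computable_iff_run by (intro exI[of _ "Comp p q"]) auto
qed

lemma computable_subst: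
  "computable f \<Longrightarrow> computable g \<Longrightarrow> computable (\<lambda>x. f (g x))"
  unfolding computable_def using partial_computable_subst[of "\<lambda>n. Some (f n)" g]
  by (simp add: computable_def)

lemma computable_Suc:
  assumes "computable f"
  shows "computable (\<lambda>x. Suc (f x))"
proof -
  have "computable (\<lambda>x. Suc x)"
    unfolding computable_iff_run by (rule exI[of _ Successor]) simp
  from computable_subst[OF this assms] show ?thesis .
qed

lemma computable_pfst:
  assumes "computable f"
  shows "computable (\<lambda>x. pfst (f x))"
proof -
  have "computable (\<lambda>x. pfst x)"
    unfolding computable_iff_run by (rule exI[of _ Proj1]) simp
  from computable_subst[OF this assms] show ?thesis .
qed

lemma computable_psnd:
  assumes "computable f"
  shows "computable (\<lambda>x. psnd (f x))"
proof -
  have "computable (\<lambda>x. psnd x)"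
    unfolding computable_iff_run by (rule exI[of _ Proj2]) simp
  from computable_subst[OF this assms] show ?thesis .
qed

lemma computable_pair:
  assumes "computable f" "computable g"
  shows "computable (\<lambda>x. pair (f x) (g x))"
proof -
  obtain p q where "\<forall>x. run p x = Some (f x)" "\<forall>x. run q x = Some (g x)"
    using assms unfolding computable_iff_run by blast
  then show ?thesis
    unfolding computable_iff_run by (intro exI[of _ "Pairing p q"]) simp
qed

text \<open>The continuation may depend on the input \<open>x\<close> as well as on the value of
  \<open>f\<close>, so the composed program hands on the pair of both.\<close>

lemma partial_computable_bind:
  assumes "partial_computable f" "partial_computable (\<lambda>z. g (pfst z) (psnd z))"
  shows "partial_computable (\<lambda>x. Option.bind (f x) (g x))"
proof -
  obtain p q where p: "run p = f" and q: "run q = (\<lambda>z. g (pfst z) (psnd z))"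
    using assms unfolding partial_computable_iff_run by blast
  obtain i where i: "\<forall>x. run i x = Some x"
    using computable_id unfolding computable_iff_run by blast
  have "run (Comp q (Pairing i p)) x = Option.bind (f x) (g x)" for x
    by (cases "f x") (auto simp: p q i)
  then show ?thesis unfolding partial_computable_iff_run by blast
qed

text \<open>\<open>PrimRec\<close> recurses on the second half of its input and keeps the first half
  as a parameter; a general bound \<open>n x\<close> is supplied afterwards by substituting
  \<open>pair x (n x)\<close>.\<close>

lemma computable_rec_nat:
  assumes a: "computable a"
    and g: "computable (\<lambda>z. g (pfst z) (pfst (psnd z)) (psnd (psnd z)))"
    and n: "computable n"
  shows "computable (\<lambda>x. rec_nat (a x) (g x) (n x))"
proof -
  obtain p q where p: "\<And>x. run p x = Some (a x)"
    and q: "\<And>z. run q z = Some (g (pfst z) (pfst (psnd z)) (psnd (psnd z)))"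
    using a g unfolding computable_iff_run by blast
  have "rec_nat (run p x) (\<lambda>k r. Option.bind r (\<lambda>v. run q (pair x (pair k v)))) m =
      Some (rec_nat (a x) (g x) m)" for x m
    by (induction m) (simp_all add: p q)
  then have "computable (\<lambda>z. rec_nat (a (pfst z)) (g (pfst z)) (psnd z))"
    unfolding computable_iff_run
    by (intro exI[of _ "PrimRec p q"]) (simp add: case_prod_beta)
  from computable_subst[OF this computable_pair[OF computable_id n]] show ?thesis by simp
qed

lemma computable_funpow:
  assumes "computable f" "computable n" "computable a"
  shows "computable (\<lambda>x. (f ^^ n x) (a x))"
proof -
  have eq: "(f ^^ m) y = rec_nat y (\<lambda>k v. f v) m" for m y
    by (induction m) simp_all
  have "computable (\<lambda>z. f (psnd (psnd z)))"
    by (intro computable_subst[OF assms(1)] computable_psnd computable_id)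
  then show ?thesis
    unfolding eq using assms by (intro computable_rec_nat)
qed

lemma computable_case_nat:
  assumes "computable a" "computable (\<lambda>z. g (pfst z) (psnd z))" "computable n"
  shows "computable (\<lambda>x. case n x of 0 \<Rightarrow> a x | Suc k \<Rightarrow> g x k)"
proof -
  \<comment> \<open>Case distinction is a primitive recursion that ignores the previous
    value.\<close>
  have eq: "(case m of 0 \<Rightarrow> a x | Suc k \<Rightarrow> g x k) = rec_nat (a x) (\<lambda>k v. g x k) m" for x m
    by (cases m) simp_all
  have "computable (\<lambda>z. g (pfst z) (pfst (psnd z)))"
    using computable_subst[OF assms(2), of "\<lambda>z. pair (pfst z) (pfst (psnd z))"]
    by (simp add: computable_pair computable_pfst computable_psnd computable_id)
  with assms show ?thesis unfolding eq by (intro computable_rec_nat)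
qed

lemma computable_pred:
  assumes "computable f"
  shows "computable (\<lambda>x. f x - Suc 0)"
proof -
  have eq: "m - Suc 0 = (case m of 0 \<Rightarrow> 0 | Suc k \<Rightarrow> k)" for m
    by (cases m) simp_all
  show ?thesis
    unfolding eq using assms
    by (intro computable_case_nat computable_const computable_psnd computable_id)
qed

lemma computable_diff:
  assumes "computable f" "computable g"
  shows "computable (\<lambda>x. f x - g x)"
proof -
  have rec: "m - n = rec_nat m (\<lambda>k v. v - Suc 0) n" for m n :: nat
    by (induction n) auto
  have eq: "f x - g x = rec_nat (f x) (\<lambda>k v. v - Suc 0) (g x)" for x
    by (rule rec)
  show ?thesis
    unfolding eq using assms
    by (intro computable_rec_nat computable_pred computable_psnd computable_id)
qed

section \<open>Decidable predicates and unbounded search\<close>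

definition decidable :: "(nat \<Rightarrow> bool) \<Rightarrow> bool" where
  "decidable P \<longleftrightarrow> computable (\<lambda>x. if P x then 0 else Suc 0)"

lemma decidable_eq_0:
  assumes "computable f"
  shows "decidable (\<lambda>x. f x = 0)"
proof -
  have eq: "(if m = 0 then 0 else Suc 0) = (case m of 0 \<Rightarrow> 0 | Suc k \<Rightarrow> Suc 0)" for m :: nat
    by (cases m) simp_all
  show ?thesis
    unfolding decidable_def eq using assms
    by (intro computable_case_nat computable_const)
qed

lemma computable_if:
  assumes "decidable P" "computable f" "computable g"
  shows "computable (\<lambda>x. if P x then f x else g x)"
proof -
  have eq: "(if P x then f x else g x) =
      (case (if P x then 0 else Suc 0) of 0 \<Rightarrow> f x | Suc k \<Rightarrow> g x)" for x
    by simp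
  have "computable (\<lambda>z. g (pfst z))"
    by (intro computable_subst[OF assms(3)] computable_pfst computable_id)
  then show ?thesis
    unfolding eq using assms unfolding decidable_def by (intro computable_case_nat)
qed

lemma decidable_not:
  assumes "decidable P"
  shows "decidable (\<lambda>x. \<not> P x)"
proof -
  have eq: "(if \<not> P x then 0 else Suc 0) = (if P x then Suc 0 else 0)" for x
    by simp
  show ?thesis
    unfolding decidable_def eq using assms by (intro computable_if computable_const)
qed

lemma decidable_conj:
  assumes "decidable P" "decidable Q"
  shows "decidable (\<lambda>x. P x \<and> Q x)"
proof -
  have eq: "(if P x \<and> Q x then 0 else Suc 0) = (if P x then if Q x then 0 else Suc 0 else Suc 0)"
    for x by simp
  show ?thesis
    unfolding decidable_def eq
    using assms by (intro computable_if computable_const)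
qed

lemma decidable_eq:
  assumes "computable f" "computable g"
  shows "decidable (\<lambda>x. f x = g x)"
proof -
  have eq: "f x = g x \<longleftrightarrow> f x - g x = 0 \<and> g x - f x = 0" for x
    by auto
  show ?thesis
    unfolding eq using assms
    by (intro decidable_conj decidable_eq_0 computable_diff)
qed

lemma decidable_subst:
  "decidable P \<Longrightarrow> computable f \<Longrightarrow> decidable (\<lambda>x. P (f x))"
  unfolding decidable_def by (rule computable_subst)

lemmas computable_intros =
  computable_id computable_const computable_Suc computable_pfst computable_psnd computable_pair
  computable_if computable_pred decidable_eq decidable_conj decidable_not

text \<open>\<open>Minimise\<close> looks for the value \<open>0\<close>, which codes truth in
  \<open>decidable\<close>. As the test program is total, the condition on earlier arguments holds
  at the least witness.\<close>

lemma partial_computable_Least: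
  assumes "decidable (\<lambda>z. P (pfst z) (psnd z))"
  shows "partial_computable (\<lambda>x. if \<exists>n. P x n then Some (LEAST n. P x n) else None)"
proof -
  obtain p where p: "\<And>z. run p z = Some (if P (pfst z) (psnd z) then 0 else Suc 0)"
    using assms unfolding decidable_def computable_iff_run by blast
  have zero: "run p (pair x n) = Some 0 \<longleftrightarrow> P x n" for x n
    by (simp add: p)
  have "(\<exists>n. P x n \<and> (\<forall>k<n. \<exists>v. run p (pair x k) = Some (Suc v))) \<longleftrightarrow> (\<exists>n. P x n)" for x
    using exists_least_iff[of "P x"] by (auto simp: p)
  then have "run (Minimise p) = (\<lambda>x. if \<exists>n. P x n then Some (LEAST n. P x n) else None)"
    by (auto simp: zero fun_eq_iff)
  then show ?thesis unfolding partial_computable_iff_run by blast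
qed

section \<open>An abstract machine for programs\<close>

text \<open>
  States are coded as numbers: \<open>eval_state e x k\<close> asks for the value of program \<open>e\<close> at \<open>x\<close>, and
  \<open>return_state v k\<close> hands the value \<open>v\<close> to the continuation \<open>k\<close>. A continuation is a stack of
  frames, coded as \<open>0\<close> when empty and as \<open>Suc (pair frame rest)\<close> otherwise.
\<close>

definition eval_state :: "nat \<Rightarrow> nat \<Rightarrow> nat \<Rightarrow> nat" where
  "eval_state e x k = pair 0 (pair e (pair x k))"

definition return_state :: "nat \<Rightarrow> nat \<Rightarrow> nat" where
  "return_state v k = pair 1 (pair v k)"

definition push :: "nat \<Rightarrow> nat \<Rightarrow> nat \<Rightarrow> nat" where
  "push t d k = Suc (pair (pair t d) k)"

definition eval_step :: "nat \<Rightarrow> nat \<Rightarrow> nat \<Rightarrow> nat" where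
  "eval_step e x k =
     (if pfst e = 0 then return_state 0 k
      else if pfst e = 1 then return_state (Suc x) k
      else if pfst e = 2 then return_state (pfst x) k
      else if pfst e = 3 then return_state (psnd x) k
      else if pfst e = 4 then
        eval_state (pfst (psnd e)) x (push 0 (pair (psnd (psnd e)) x) k)
      else if pfst e = 5 then
        eval_state (psnd (psnd e)) x (push 2 (pfst (psnd e)) k)
      else if pfst e = 6 then
        eval_state (pfst (psnd e)) (pfst x)
          (push 3 (pair (pair (psnd (psnd e)) (pfst x)) (pair 0 (psnd x))) k)
      else eval_state (psnd e) (pair x 0) (push 4 (pair (pair (psnd e) x) 0) k))"

text \<open>The tag \<open>t\<close> tells what the frame waits for: \<open>0\<close> and
  \<open>1\<close> for the first and second component of a pairing, \<open>2\<close> for the inner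
  value of a composition, \<open>3\<close> for a stage of a primitive recursion (data: step program
  and parameter, then counter and bound), \<open>4\<close> for a test of a search (data: program and
  argument, then candidate).\<close>

definition return_step :: "nat \<Rightarrow> nat \<Rightarrow> nat \<Rightarrow> nat \<Rightarrow> nat" where
  "return_step v t d k =
     (if t = 0 then eval_state (pfst d) (psnd d) (push 1 v k)
      else if t = 1 then return_state (pair d v) k
      else if t = 2 then eval_state d v k
      else if t = 3 then
        (if pfst (psnd d) = psnd (psnd d) then return_state v k
         else eval_state (pfst (pfst d)) (pair (psnd (pfst d)) (pair (pfst (psnd d)) v))
                (push 3 (pair (pfst d) (pair (Suc (pfst (psnd d))) (psnd (psnd d)))) k))
      else
        (if v = 0 then return_state (psnd d) k
         else eval_state (pfst (pfst d)) (pair (psnd (pfst d)) (Suc (psnd d)))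
                (push 4 (pair (pfst d) (Suc (psnd d))) k)))"

text \<open>A value returned to the empty continuation is a fixed point, so a halted run stays
  halted however many further steps are counted.\<close>

definition step :: "nat \<Rightarrow> nat" where
  "step s =
     (if pfst s = 0 then eval_step (pfst (psnd s)) (pfst (psnd (psnd s))) (psnd (psnd (psnd s)))
      else if psnd (psnd s) = 0 then s
      else return_step (pfst (psnd s)) (pfst (pfst (psnd (psnd s) - Suc 0)))
             (psnd (pfst (psnd (psnd s) - Suc 0))) (psnd (psnd (psnd s) - Suc 0)))"

lemma step_eval_state: "step (eval_state e x k) = eval_step e x k"
  by (simp add: step_def eval_state_def)

lemma step_return_state_push: "step (return_state v (push t d k)) = return_step v t d k"
  by (simp add: step_def return_state_def push_def)

lemma step_return_state_0: "step (return_state v 0) = return_state v 0"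
  by (simp add: step_def return_state_def)

lemma funpow_step_return_state_0: "(step ^^ n) (return_state v 0) = return_state v 0"
  by (induction n) (simp_all add: step_return_state_0)

lemma computable_step: "computable step"
proof -
  have "computable (\<lambda>s. step s)"
    unfolding step_def eval_step_def return_step_def eval_state_def return_state_def push_def
    by (intro computable_intros)
  then show ?thesis .
qed

lemma return_state_inject [simp]: "return_state v k = return_state v' k' \<longleftrightarrow> v = v' \<and> k = k'"
  by (simp add: return_state_def)

lemma eval_state_neq_return_state [simp]: "eval_state e x k \<noteq> return_state v' k'"
  by (simp add: return_state_def eval_state_def)

section \<open>From values of programs to halting runs of the machine\<close>

definition reaches :: "nat \<Rightarrow> nat \<Rightarrow> bool" where
  "reaches s t \<longleftrightarrow> (\<exists>n. (step ^^ n) s = t)"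

lemma reaches_refl: "reaches s s"
  unfolding reaches_def by (rule exI[of _ 0]) simp

lemma reaches_trans [trans]: "reaches s t \<Longrightarrow> reaches t u \<Longrightarrow> reaches s u"
  unfolding reaches_def by (metis comp_apply funpow_add)

lemma reaches_step: "reaches (step s) t \<Longrightarrow> reaches s t"
  unfolding reaches_def by (metis comp_apply funpow_Suc_right)

text \<open>\<open>n\<close> is the first zero and \<open>f\<close> gives the predecessors of the
  positive values before it. The distance \<open>n - j\<close> still to be searched shrinks from
  round to round.\<close>

lemma reaches_minimise:
  assumes "\<And>j. j \<le> n \<Longrightarrow>
      reaches (eval_state m (pair x j) (push 4 (pair (pair m x) j) k))
        (return_state (if j = n then 0 else Suc (f j)) (push 4 (pair (pair m x) j) k))"
  shows "j \<le> n \<Longrightarrow>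
    reaches (eval_state m (pair x j) (push 4 (pair (pair m x) j) k)) (return_state n k)"
proof (induction "n - j" arbitrary: j)
  case 0
  then have "j = n" by simp
  have "reaches (eval_state m (pair x j) (push 4 (pair (pair m x) j) k))
      (return_state 0 (push 4 (pair (pair m x) j) k))"
    using assms[of j] \<open>j = n\<close> by simp
  also have "reaches \<dots> (return_state n k)"
    by (rule reaches_step)
       (simp add: step_return_state_push return_step_def \<open>j = n\<close> reaches_refl)
  finally show ?case .
next
  case (Suc d)
  then have "j < n" by simp
  have "reaches (eval_state m (pair x j) (push 4 (pair (pair m x) j) k))
      (return_state (Suc (f j)) (push 4 (pair (pair m x) j) k))"
    using assms[of j] \<open>j < n\<close> by simp
  also have "reaches \<dots> (return_state n k)"
    using Suc(1)[of "Suc j"] Suc(2) \<open>j < n\<close>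
    by (intro reaches_step[of "return_state _ _"])
       (simp add: step_return_state_push return_step_def)
  finally show ?case .
qed

text \<open>The invariant is that \<open>f j\<close> is returned to a frame whose counter is
  \<open>j\<close>; the frame is popped when the counter equals \<open>n\<close>.\<close>

lemma reaches_primrec:
  assumes "reaches (eval_state p a (push 3 (pair (pair q a) (pair 0 n)) k))
             (return_state (f 0) (push 3 (pair (pair q a) (pair 0 n)) k))"
    and "\<And>j. j < n \<Longrightarrow>
      reaches (eval_state q (pair a (pair j (f j))) (push 3 (pair (pair q a) (pair (Suc j) n)) k))
        (return_state (f (Suc j)) (push 3 (pair (pair q a) (pair (Suc j) n)) k))"
  shows "reaches (eval_state p a (push 3 (pair (pair q a) (pair 0 n)) k)) (return_state (f n) k)"
proof -
  have "j \<le> n \<Longrightarrow> reaches (eval_state p a (push 3 (pair (pair q a) (pair 0 n)) k))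
             (return_state (f j) (push 3 (pair (pair q a) (pair j n)) k))" for j
  proof (induction j)
    case (Suc j)
    then have "reaches (eval_state p a (push 3 (pair (pair q a) (pair 0 n)) k))
             (return_state (f j) (push 3 (pair (pair q a) (pair j n)) k))" by simp
    also have "reaches \<dots> (return_state (f (Suc j)) (push 3 (pair (pair q a) (pair (Suc j) n)) k))"
      using assms(2)[of j] Suc.prems
      by (intro reaches_step[of "return_state (f j) _"])
         (simp add: step_return_state_push return_step_def)
    finally show ?case .
  qed (use assms(1) in simp)
  from this[of n] show ?thesis
    by (rule reaches_trans[OF _ reaches_step])
       (simp_all add: step_return_state_push return_step_def reaches_refl)
qed

text \<open>A defined recursion has only defined intermediate values. Collecting them in one
  function \<open>f\<close> gives the form that \<open>reaches_primrec\<close> takes as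
  input.\<close>

lemma run_PrimRec_Some:
  assumes "run (PrimRec p q) (pair a n) = Some v"
  obtains f where "run p a = Some (f 0)"
    "\<And>j. j < n \<Longrightarrow> run q (pair a (pair j (f j))) = Some (f (Suc j))" "f n = v"
proof -
  let ?r = "rec_nat (run p a) (\<lambda>k r. Option.bind r (\<lambda>v. run q (pair a (pair k v))))"
  have "\<exists>f. run p a = Some (f 0) \<and>
      (\<forall>j<n. run q (pair a (pair j (f j))) = Some (f (Suc j))) \<and> f n = v"
    if "?r n = Some v" for v n
    using that
  proof (induction n arbitrary: v)
    case 0
    then show ?case by (intro exI[of _ "\<lambda>_. v"]) simp
  next
    case (Suc n)
    then obtain w where w: "?r n = Some w" "run q (pair a (pair n w)) = Some v"
      by (auto simp: bind_eq_Some_conv)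
    then obtain f where "run p a = Some (f 0)"
      "\<forall>j<n. run q (pair a (pair j (f j))) = Some (f (Suc j))" "f n = w"
      using Suc.IH by blast
    with w show ?case
      by (intro exI[of _ "f(Suc n := v)"]) (auto simp: less_Suc_eq)
  qed
  with assms that show thesis by fastforce
qed

lemma prog_of_Zero: "prog_of e = Zero \<Longrightarrow> pfst e = 0"
  by (subst (asm) prog_of.simps) (auto simp: Let_def split: if_splits)

lemma prog_of_Successor: "prog_of e = Successor \<Longrightarrow> pfst e = 1"
  by (subst (asm) prog_of.simps) (auto simp: Let_def split: if_splits)

lemma prog_of_Proj1: "prog_of e = Proj1 \<Longrightarrow> pfst e = 2"
  by (subst (asm) prog_of.simps) (auto simp: Let_def split: if_splits)

lemma prog_of_Proj2: "prog_of e = Proj2 \<Longrightarrow> pfst e = 3"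
  by (subst (asm) prog_of.simps) (auto simp: Let_def split: if_splits)

lemma prog_of_Pairing:
  "prog_of e = Pairing p q \<Longrightarrow>
    pfst e = 4 \<and> prog_of (pfst (psnd e)) = p \<and> prog_of (psnd (psnd e)) = q"
  by (subst (asm) prog_of.simps) (auto simp: Let_def split: if_splits)

lemma prog_of_Comp:
  "prog_of e = Comp p q \<Longrightarrow>
    pfst e = 5 \<and> prog_of (pfst (psnd e)) = p \<and> prog_of (psnd (psnd e)) = q"
  by (subst (asm) prog_of.simps) (auto simp: Let_def split: if_splits)

lemma prog_of_PrimRec:
  "prog_of e = PrimRec p q \<Longrightarrow>
    pfst e = 6 \<and> prog_of (pfst (psnd e)) = p \<and> prog_of (psnd (psnd e)) = q"
  by (subst (asm) prog_of.simps) (auto simp: Let_def split: if_splits)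

text \<open>The tag is only bounded below, because every tag from \<open>7\<close> on is read as
  \<open>Minimise\<close>.\<close>

lemma prog_of_Minimise:
  "prog_of e = Minimise p \<Longrightarrow> pfst e > 6 \<and> prog_of (psnd e) = p"
  by (subst (asm) prog_of.simps) (auto simp: Let_def split: if_splits)

text \<open>By induction on the program. The continuation \<open>k\<close> is arbitrary because
  subprograms run on top of frames pushed by their caller; \<open>e\<close> is arbitrary because
  each subprogram has its own code.\<close>

lemma reaches_of_run_prog:
  "run p x = Some v \<Longrightarrow> prog_of e = p \<Longrightarrow> reaches (eval_state e x k) (return_state v k)"
proof (induction p arbitrary: e x v k)
  case Zero
  then show ?case
    using prog_of_Zero[of e]
    by (intro reaches_step[of "eval_state e x k"])
       (simp add: step_eval_state eval_step_def reaches_refl)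
next
  case Successor
  then show ?case
    using prog_of_Successor[of e]
    by (intro reaches_step[of "eval_state e x k"])
       (auto simp add: step_eval_state eval_step_def reaches_refl)
next
  case Proj1
  then show ?case
    using prog_of_Proj1[of e]
    by (intro reaches_step[of "eval_state e x k"])
       (auto simp add: step_eval_state eval_step_def reaches_refl)
next
  case Proj2
  then show ?case
    using prog_of_Proj2[of e]
    by (intro reaches_step[of "eval_state e x k"])
       (auto simp add: step_eval_state eval_step_def reaches_refl)
next
  case (Pairing p q)
  let ?a = "pfst (psnd e)" and ?b = "psnd (psnd e)"
  from Pairing.prems(1) obtain a b where ab: "run p x = Some a" "run q x = Some b" "v = pair a b"
    by (auto simp: bind_eq_Some_conv)
  note e = prog_of_Pairing[OF Pairing.prems(2)]
  have "reaches (eval_state e x k) (eval_state ?a x (push 0 (pair ?b x) k))"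
    by (rule reaches_step) (simp add: e step_eval_state eval_step_def reaches_refl)
  also have "reaches \<dots> (return_state a (push 0 (pair ?b x) k))"
    using Pairing.IH(1)[OF ab(1)] e by blast
  also have "reaches \<dots> (eval_state ?b x (push 1 a k))"
    by (rule reaches_step) (simp add: step_return_state_push return_step_def reaches_refl)
  also have "reaches \<dots> (return_state b (push 1 a k))"
    using Pairing.IH(2)[OF ab(2)] e by blast
  also have "reaches \<dots> (return_state v k)"
    by (rule reaches_step) (simp add: step_return_state_push return_step_def reaches_refl ab(3))
  finally show ?case .
next
  case (Comp p q)
  let ?a = "pfst (psnd e)" and ?b = "psnd (psnd e)"
  from Comp.prems(1) obtain a where a: "run q x = Some a" "run p a = Some v"
    by (auto simp: bind_eq_Some_conv)
  note e = prog_of_Comp[OF Comp.prems(2)]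
  have "reaches (eval_state e x k) (eval_state ?b x (push 2 ?a k))"
    by (rule reaches_step) (simp add: e step_eval_state eval_step_def reaches_refl)
  also have "reaches \<dots> (return_state a (push 2 ?a k))"
    using Comp.IH(2)[OF a(1)] e by blast
  also have "reaches \<dots> (eval_state ?a a k)"
    by (rule reaches_step) (simp add: step_return_state_push return_step_def reaches_refl)
  also have "reaches \<dots> (return_state v k)"
    using Comp.IH(1)[OF a(2)] e by blast
  finally show ?case .
next
  case (PrimRec p q)
  let ?a = "pfst (psnd e)" and ?b = "psnd (psnd e)"
  have "run (PrimRec p q) (pair (pfst x) (psnd x)) = Some v"
    using PrimRec.prems(1) by (simp only: pair_pfst_psnd)
  then obtain f where f: "run p (pfst x) = Some (f 0)"
    "\<And>j. j < psnd x \<Longrightarrow> run q (pair (pfst x) (pair j (f j))) = Some (f (Suc j))"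
    "f (psnd x) = v"
    by (rule run_PrimRec_Some) blast
  note e = prog_of_PrimRec[OF PrimRec.prems(2)]
  have "reaches (eval_state e x k)
      (eval_state ?a (pfst x) (push 3 (pair (pair ?b (pfst x)) (pair 0 (psnd x))) k))"
    by (rule reaches_step) (simp add: e step_eval_state eval_step_def reaches_refl)
  also have "reaches \<dots> (return_state (f (psnd x)) k)"
    using PrimRec.IH(1)[OF f(1)] PrimRec.IH(2)[OF f(2)] e by (intro reaches_primrec) blast+
  finally show ?case by (simp add: f(3))
next
  case (Minimise p)
  let ?a = "psnd e"
  let ?P = "\<lambda>n. run p (pair x n) = Some 0"
  note e = prog_of_Minimise[OF Minimise.prems(2)]
  have ex: "\<exists>n. ?P n \<and> (\<forall>j<n. \<exists>w. run p (pair x j) = Some (Suc w))"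
    and v: "v = (LEAST n. ?P n)"
    using Minimise.prems(1) by (auto split: if_splits)
  then obtain n where n: "?P n" "\<And>j. j < n \<Longrightarrow> \<exists>w. run p (pair x j) = Some (Suc w)"
    by blast
  \<comment> \<open>All values before the zero \<open>n\<close> are positive, so it is the least
    zero.\<close>
  have "v = n"
    unfolding v using n by (intro Least_equality) (force simp: not_less[symmetric])+
  obtain f where f: "\<And>j. j < n \<Longrightarrow> run p (pair x j) = Some (Suc (f j))"
    using n(2) by metis
  have "run p (pair x j) = Some (if j = n then 0 else Suc (f j))" if "j \<le> n" for j
    using that n(1) f by auto
  then have loop: "reaches (eval_state ?a (pair x j) (push 4 (pair (pair ?a x) j) k))
      (return_state (if j = n then 0 else Suc (f j)) (push 4 (pair (pair ?a x) j) k))"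
    if "j \<le> n" for j
    using that Minimise.IH e by blast
  have "reaches (eval_state e x k) (eval_state ?a (pair x 0) (push 4 (pair (pair ?a x) 0) k))"
    using e by (intro reaches_step[of "eval_state e x k"])
      (auto simp: step_eval_state eval_step_def reaches_refl)
  also have "reaches \<dots> (return_state n k)"
    using loop by (rule reaches_minimise) auto
  finally show ?case by (simp add: \<open>v = n\<close>)
qed

section \<open>From halting runs back to values of programs\<close>

lemma halting_return_state_push:
  assumes "(step ^^ n) (return_state v (push t d k)) = return_state w 0"
  obtains m where "n = Suc m" "(step ^^ m) (return_step v t d k) = return_state w 0"
  using assms by (cases n)
    (auto simp: push_def funpow_Suc_right step_return_state_push[unfolded push_def]
      simp del: funpow.simps)

text \<open>The premise \<open>eval\<close> is the induction hypothesis of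
  \<open>halting_eval_state\<close> for runs shorter than \<open>n\<close>. Every round of the loop
  consumes steps, which allows strong induction on \<open>m\<close>; the invariant is that
  \<open>v\<close> is the value of the recursion at \<open>j\<close>.\<close>

lemma halting_primrec:
  assumes eval: "\<And>m x k. m < n \<Longrightarrow> (step ^^ m) (eval_state q x k) = return_state w 0 \<Longrightarrow>
      \<exists>v l. l < m \<and> run (prog_of q) x = Some v \<and> (step ^^ l) (return_state v k) = return_state w 0"
    and "(step ^^ m) (return_state v (push 3 (pair (pair q a) (pair j N)) k)) = return_state w 0"
    and "m < n" "run (PrimRec p (prog_of q)) (pair a j) = Some v"
  shows "\<exists>v l. l < m \<and> run (PrimRec p (prog_of q)) (pair a N) = Some v \<and>
      (step ^^ l) (return_state v k) = return_state w 0"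
  using assms(2-)
proof (induction m arbitrary: j v rule: less_induct)
  case (less m)
  obtain m' where m': "m = Suc m'" and
    s: "(step ^^ m') (return_step v 3 (pair (pair q a) (pair j N)) k) = return_state w 0"
    using less.prems(1) by (rule halting_return_state_push)
  show ?case
  proof (cases "j = N")
    case True
    with s m' less.prems show ?thesis by (auto simp: return_step_def)
  next
    case False
    then have "(step ^^ m') (eval_state q (pair a (pair j v))
        (push 3 (pair (pair q a) (pair (Suc j) N)) k)) = return_state w 0"
      using s by (simp add: return_step_def)
    from eval[OF _ this] m' less.prems obtain v' l where l: "l < m'"
      "run (prog_of q) (pair a (pair j v)) = Some v'"
      "(step ^^ l) (return_state v' (push 3 (pair (pair q a) (pair (Suc j) N)) k)) = return_state w 0"
      by auto
    have "run (PrimRec p (prog_of q)) (pair a (Suc j)) = Some v'"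
      using less.prems(3) l(2) by simp
    from less.IH[OF _ l(3) _ this] l m' less.prems(2) show ?thesis
      by (meson less_trans lessI)
  qed
qed

text \<open>As for primitive recursion, with the invariant that all tests before \<open>j\<close>
  gave positive values; a zero at \<open>j\<close> is then the least one.\<close>

lemma halting_minimise:
  assumes eval: "\<And>m x k. m < n \<Longrightarrow> (step ^^ m) (eval_state q x k) = return_state w 0 \<Longrightarrow>
      \<exists>v l. l < m \<and> run (prog_of q) x = Some v \<and> (step ^^ l) (return_state v k) = return_state w 0"
    and "(step ^^ m) (eval_state q (pair x j) (push 4 (pair (pair q x) j) k)) = return_state w 0"
    and "m < n" "\<forall>i<j. \<exists>u. run (prog_of q) (pair x i) = Some (Suc u)"
  shows "\<exists>v l. l < m \<and> run (Minimise (prog_of q)) x = Some v \<and>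
      (step ^^ l) (return_state v k) = return_state w 0"
  using assms(2-)
proof (induction m arbitrary: j rule: less_induct)
  case (less m)
  from eval[OF less.prems(2,1)] obtain u l where l: "l < m" "run (prog_of q) (pair x j) = Some u"
    "(step ^^ l) (return_state u (push 4 (pair (pair q x) j) k)) = return_state w 0" by blast
  obtain l' where l': "l = Suc l'" and
    s: "(step ^^ l') (return_step u 4 (pair (pair q x) j) k) = return_state w 0"
    using l(3) by (rule halting_return_state_push)
  show ?case
  proof (cases u)
    case 0
    have "(LEAST i. run (prog_of q) (pair x i) = Some 0) = j"
      using l(2) 0 less.prems(3)
      by (intro Least_equality) (force simp: not_less[symmetric])+
    then have "run (Minimise (prog_of q)) x = Some j"
      using l(2) 0 less.prems(3) by auto
    moreover have "(step ^^ l') (return_state j k) = return_state w 0"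
      using s 0 by (simp add: return_step_def)
    ultimately show ?thesis using l l' by (metis less_trans lessI)
  next
    case (Suc u')
    have "\<forall>i<Suc j. \<exists>u. run (prog_of q) (pair x i) = Some (Suc u)"
      using less.prems(3) l(2) Suc by (auto simp: less_Suc_eq)
    moreover have "(step ^^ l') (eval_state q (pair x (Suc j)) (push 4 (pair (pair q x) (Suc j)) k)) =
        return_state w 0"
      using s Suc by (simp add: return_step_def)
    ultimately have "\<exists>v i. i < l' \<and> run (Minimise (prog_of q)) x = Some v \<and>
        (step ^^ i) (return_state v k) = return_state w 0"
      using l l' less.prems(2) by (intro less.IH) simp_all
    then show ?thesis using l l' by (meson less_trans lessI)
  qed
qed

text \<open>The induction is on the number of steps: a halting run of a compound program splits into
  strictly shorter runs of its parts, since starting a part and popping a frame each cost a step.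
  The conclusion keeps the rest of the run, from the returned value on, for the enclosing
  frame.\<close>

lemma halting_eval_state:
  "(step ^^ n) (eval_state e x k) = return_state w 0 \<Longrightarrow>
    \<exists>v m. m < n \<and> run (prog_of e) x = Some v \<and> (step ^^ m) (return_state v k) = return_state w 0"
proof (induction n arbitrary: e x k rule: less_induct)
  case (less n)
  let ?a = "pfst (psnd e)" and ?b = "psnd (psnd e)"
  obtain n' where n': "n = Suc n'" and s: "(step ^^ n') (eval_step e x k) = return_state w 0"
    using less.prems by (cases n) (auto simp: funpow_Suc_right step_eval_state simp del: funpow.simps)
  consider "pfst e < 4" | "pfst e = 4" | "pfst e = 5" | "pfst e = 6" | "pfst e > 6"
    by linarith
  then show ?case
  proof cases
    case 1
    then have "pfst e = 0 \<or> pfst e = 1 \<or> pfst e = 2 \<or> pfst e = 3" by auto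
    then show ?thesis
      using s n' by (subst prog_of.simps) (auto simp: eval_step_def)
  next
    case 2
    then have p: "prog_of e = Pairing (prog_of ?a) (prog_of ?b)"
      by (subst prog_of.simps) (simp add: Let_def)
    have "(step ^^ n') (eval_state ?a x (push 0 (pair ?b x) k)) = return_state w 0"
      using s 2 by (simp add: eval_step_def)
    from less.IH[OF _ this] n' obtain a m where a: "m < n'" "run (prog_of ?a) x = Some a"
      "(step ^^ m) (return_state a (push 0 (pair ?b x) k)) = return_state w 0" by auto
    obtain m' where m': "m = Suc m'" "(step ^^ m') (eval_state ?b x (push 1 a k)) = return_state w 0"
      using a(3) by (rule halting_return_state_push) (simp add: return_step_def)
    from less.IH[OF _ m'(2)] n' m'(1) a(1) obtain b l where b: "l < m'"
      "run (prog_of ?b) x = Some b" "(step ^^ l) (return_state b (push 1 a k)) = return_state w 0"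
      by auto
    obtain l' where "l = Suc l'" "(step ^^ l') (return_state (pair a b) k) = return_state w 0"
      using b(3) by (rule halting_return_state_push) (simp add: return_step_def)
    moreover have "run (prog_of e) x = Some (pair a b)"
      by (simp add: p a b)
    ultimately show ?thesis using a b m' n' by (intro exI[of _ "pair a b"] exI[of _ l']) simp
  next
    case 3
    then have p: "prog_of e = Comp (prog_of ?a) (prog_of ?b)"
      by (subst prog_of.simps) (simp add: Let_def)
    have "(step ^^ n') (eval_state ?b x (push 2 ?a k)) = return_state w 0"
      using s 3 by (simp add: eval_step_def)
    from less.IH[OF _ this] n' obtain a m where a: "m < n'" "run (prog_of ?b) x = Some a"
      "(step ^^ m) (return_state a (push 2 ?a k)) = return_state w 0" by auto
    obtain m' where m': "m = Suc m'" "(step ^^ m') (eval_state ?a a k) = return_state w 0"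
      using a(3) by (rule halting_return_state_push) (simp add: return_step_def)
    from less.IH[OF _ m'(2)] n' m'(1) a(1) obtain v l where "l < m'"
      "run (prog_of ?a) a = Some v" "(step ^^ l) (return_state v k) = return_state w 0"
      by auto
    then show ?thesis using a m' n' by (intro exI[of _ v] exI[of _ l]) (simp add: p)
  next
    case 4
    then have p: "prog_of e = PrimRec (prog_of ?a) (prog_of ?b)"
      by (subst prog_of.simps) (simp add: Let_def)
    let ?k = "push 3 (pair (pair ?b (pfst x)) (pair 0 (psnd x))) k"
    have "(step ^^ n') (eval_state ?a (pfst x) ?k) = return_state w 0"
      using s 4 by (simp add: eval_step_def)
    from less.IH[OF _ this] n' obtain a m where a: "m < n'" "run (prog_of ?a) (pfst x) = Some a"
      "(step ^^ m) (return_state a ?k) = return_state w 0" by auto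
    have "\<exists>v l. l < m \<and> run (PrimRec (prog_of ?a) (prog_of ?b)) (pair (pfst x) (psnd x)) = Some v \<and>
        (step ^^ l) (return_state v k) = return_state w 0"
      using less.IH a(3) by (rule halting_primrec) (use a n' in simp_all)
    then show ?thesis
      using a n' unfolding p pair_pfst_psnd by (meson less_trans lessI)
  next
    case 5
    then have p: "prog_of e = Minimise (prog_of (psnd e))"
      by (subst prog_of.simps) (simp add: Let_def)
    have "(step ^^ n') (eval_state (psnd e) (pair x 0) (push 4 (pair (pair (psnd e) x) 0) k)) =
        return_state w 0"
      using s 5 by (simp add: eval_step_def)
    from halting_minimise[of n, OF less.IH this] n'
    have "\<exists>v l. l < n' \<and> run (Minimise (prog_of (psnd e))) x = Some v \<and>
        (step ^^ l) (return_state v k) = return_state w 0"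
      by simp
    then show ?thesis
      using n' unfolding p by (meson less_trans lessI)
  qed
qed

text \<open>Both directions take the empty continuation. Final states being fixed, the value
  supplied by \<open>halting_eval_state\<close> is the one in the final state.\<close>

lemma phi_eq_Some_iff:
  "\<phi> e x = Some v \<longleftrightarrow> (\<exists>n. (step ^^ n) (eval_state e x 0) = return_state v 0)"
proof
  assume "\<phi> e x = Some v"
  then show "\<exists>n. (step ^^ n) (eval_state e x 0) = return_state v 0"
    using reaches_of_run_prog[of "prog_of e" x v e 0] by (simp add: \<phi>_def reaches_def)
next
  assume "\<exists>n. (step ^^ n) (eval_state e x 0) = return_state v 0"
  then show "\<phi> e x = Some v"
    using halting_eval_state[of _ e x 0 v] by (auto simp: \<phi>_def funpow_step_return_state_0)
qed

section \<open>Step-bounded computation and the universal function\<close>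

definition outcome :: "nat \<Rightarrow> nat \<Rightarrow> nat \<Rightarrow> nat" where
  "outcome e x n = pfst (psnd ((step ^^ n) (eval_state e x 0)))"

text \<open>\<open>outcome\<close> reads a field of whatever state has been reached. Comparing that
  state with the final state carrying this field makes halting a decidable equality of
  numbers.\<close>

definition halts_within :: "nat \<Rightarrow> nat \<Rightarrow> nat \<Rightarrow> bool" where
  "halts_within e x n \<longleftrightarrow> (step ^^ n) (eval_state e x 0) = return_state (outcome e x n) 0"

lemma halts_within_iff:
  "halts_within e x n \<longleftrightarrow> (\<exists>v. (step ^^ n) (eval_state e x 0) = return_state v 0)"
  unfolding halts_within_def outcome_def by (auto simp: return_state_def)

lemma halts_within_0: "\<not> halts_within e x 0"
  by (simp add: halts_within_iff)

lemma halts_within_mono: "halts_within e x m \<Longrightarrow> m \<le> n \<Longrightarrow> halts_within e x n"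
  unfolding halts_within_iff
  by (metis comp_apply funpow_add funpow_step_return_state_0 le_add_diff_inverse2)

lemma phi_eq_outcome: "halts_within e x n \<Longrightarrow> \<phi> e x = Some (outcome e x n)"
  unfolding phi_eq_Some_iff halts_within_def by blast

lemma mem_W_iff: "x \<in> W e \<longleftrightarrow> (\<exists>n. halts_within e x n)"
  by (auto simp: W_def dom_def phi_eq_Some_iff halts_within_iff)

lemma computable_outcome:
  assumes "computable e" "computable x" "computable n"
  shows "computable (\<lambda>z. outcome (e z) (x z) (n z))"
  unfolding outcome_def eval_state_def using assms
  by (intro computable_intros computable_funpow[OF computable_step])

lemma decidable_halts_within:
  assumes "computable e" "computable x" "computable n"
  shows "decidable (\<lambda>z. halts_within (e z) (x z) (n z))"
  unfolding halts_within_def return_state_def using assms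
  unfolding eval_state_def
  by (intro computable_intros computable_outcome computable_funpow[OF computable_step])

text \<open>Search for the least halting time, then read off the outcome there.\<close>

lemma partial_computable_phi: "partial_computable (\<lambda>z. \<phi> (pfst z) (psnd z))"
proof -
  let ?halt = "\<lambda>z n. halts_within (pfst z) (psnd z) n"
  have "\<phi> (pfst z) (psnd z) =
      Option.bind (if \<exists>n. ?halt z n then Some (LEAST n. ?halt z n) else None)
        (\<lambda>n. Some (outcome (pfst z) (psnd z) n))" for z
  proof (cases "\<exists>n. ?halt z n")
    case True
    then have "?halt z (LEAST n. ?halt z n)" by (rule LeastI_ex)
    then show ?thesis using True phi_eq_outcome by simp
  next
    case False
    then show ?thesis using mem_W_iff[of "psnd z" "pfst z"] by (auto simp: W_def)
  qed
  moreover have "partial_computable (\<lambda>z.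
      Option.bind (if \<exists>n. ?halt z n then Some (LEAST n. ?halt z n) else None)
        (\<lambda>n. Some (outcome (pfst z) (psnd z) n)))"
    by (intro partial_computable_bind partial_computable_Least partial_computable_Some
        decidable_halts_within computable_outcome computable_intros)
  ultimately show ?thesis by simp
qed

section \<open>Computably enumerable sets\<close>

lemma smn:
  assumes "partial_computable (\<lambda>z. g (pfst z) (psnd z))"
  obtains r where "computable r" "\<And>n x. \<phi> (r n) x = g n x"
proof -
  obtain e where e: "\<phi> e = (\<lambda>z. g (pfst z) (psnd z))"
    using assms unfolding partial_computable_def by metis
  obtain i where i: "\<And>x. \<phi> i x = Some x"
    using computable_id unfolding computable_def partial_computable_def by metis
  \<comment> \<open>\<open>c n\<close> codes the program with constant value \<open>n\<close>:
    \<open>Successor\<close> applied \<open>n\<close> times after \<open>Zero\<close>.\<close>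
  define c where "c = rec_nat (pair 0 0) (\<lambda>_ v. pair 5 (pair (pair 1 0) v))"
  have "prog_of (pair 0 0) = Zero" "prog_of (pair 1 0) = Successor"
    by (subst prog_of.simps, simp)+
  moreover have Comp: "prog_of (pair 5 (pair a b)) = Comp (prog_of a) (prog_of b)" for a b
    by (subst prog_of.simps) simp
  ultimately have c: "run (prog_of (c n)) x = Some n" for n x
    by (induction n) (simp_all add: c_def)
  have Pairing: "prog_of (pair 4 (pair a b)) = Pairing (prog_of a) (prog_of b)" for a b
    by (subst prog_of.simps) simp
  \<comment> \<open>The code of the program that pairs the constant \<open>n\<close> with its input
    and then runs \<open>e\<close>; \<open>r\<close> only assembles this code.\<close>
  define r where "r n = pair 5 (pair e (pair 4 (pair (c n) i)))" for n
  have "\<phi> (r n) x = g n x" for n x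
    using e i by (simp add: \<phi>_def r_def Comp Pairing c)
  moreover have "computable (\<lambda>n. r n)"
    unfolding r_def c_def by (intro computable_intros computable_rec_nat)
  ultimately show thesis using that by blast
qed

lemma ce_iff_dom: "ce A \<longleftrightarrow> (\<exists>f. partial_computable f \<and> A = dom f)"
  unfolding ce_def partial_computable_def W_def by blast

text \<open>In one direction the witness is a number of steps; in the other, unbounded search for a
  witness is a partial function with the right domain.\<close>

lemma ce_iff_decidable:
  "ce A \<longleftrightarrow> (\<exists>P. decidable (\<lambda>z. P (pfst z) (psnd z)) \<and> A = {x. \<exists>n. P x n})"
proof
  assume "ce A"
  then obtain e where "A = W e" unfolding ce_def by blast
  then show "\<exists>P. decidable (\<lambda>z. P (pfst z) (psnd z)) \<and> A = {x. \<exists>n. P x n}"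
    by (intro exI[of _ "halts_within e"] conjI decidable_halts_within computable_intros)
       (auto simp: mem_W_iff)
next
  assume "\<exists>P. decidable (\<lambda>z. P (pfst z) (psnd z)) \<and> A = {x. \<exists>n. P x n}"
  then obtain P where P: "decidable (\<lambda>z. P (pfst z) (psnd z))" and A: "A = {x. \<exists>n. P x n}"
    by blast
  show "ce A"
    unfolding ce_iff_dom
    by (rule exI, rule conjI, rule partial_computable_Least[OF P]) (auto simp: A dom_def)
qed

lemma ce_decidable: "decidable P \<Longrightarrow> ce {x. P x}"
  unfolding ce_iff_decidable
  by (rule exI[of _ "\<lambda>x n. P x"])
     (use decidable_subst[of P pfst] computable_pfst[OF computable_id] in simp)

lemma ce_subst: "ce {x. P x} \<Longrightarrow> computable f \<Longrightarrow> ce {x. P (f x)}"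
  unfolding ce_iff_dom using partial_computable_subst[of _ f] by (fastforce simp: dom_def set_eq_iff)

lemma ce_mem: "ce A \<Longrightarrow> computable f \<Longrightarrow> ce {x. f x \<in> A}"
  using ce_subst[of "\<lambda>x. x \<in> A" f] by simp

lemma ce_mem_W:
  assumes "computable f" "computable e"
  shows "ce {x. f x \<in> W (e x)}"
proof -
  have "partial_computable (\<lambda>x. \<phi> (e x) (f x))"
    using partial_computable_subst[OF partial_computable_phi computable_pair[OF assms(2,1)]] by simp
  then show ?thesis
    unfolding ce_iff_dom by (intro exI[of _ "\<lambda>x. \<phi> (e x) (f x)"]) (auto simp: W_def dom_def)
qed

lemma ce_conj:
  assumes "ce {x. P x}" "ce {x. Q x}"
  shows "ce {x. P x \<and> Q x}"
proof -
  obtain f g where f: "partial_computable f" "{x. P x} = dom f"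
    and g: "partial_computable g" "{x. Q x} = dom g"
    using assms unfolding ce_iff_dom by blast
  have "partial_computable (\<lambda>x. Option.bind (f x) (\<lambda>_. g x))"
    by (intro partial_computable_bind f partial_computable_subst[OF g(1)] computable_intros)
  moreover have "{x. P x \<and> Q x} = dom (\<lambda>x. Option.bind (f x) (\<lambda>_. g x))"
    using f(2) g(2) by (auto simp: dom_def set_eq_iff bind_eq_Some_conv)
  ultimately show ?thesis unfolding ce_iff_dom by blast
qed

text \<open>The value \<open>y\<close> and the witness for \<open>P x y\<close> are sought together
  as one coded pair.\<close>

lemma ce_ex:
  assumes "ce {z. P (pfst z) (psnd z)}"
  shows "ce {x. \<exists>y. P x y}"
proof -
  obtain R where R: "decidable (\<lambda>z. R (pfst z) (psnd z))"
    and P: "{z. P (pfst z) (psnd z)} = {z. \<exists>n. R z n}"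
    using assms unfolding ce_iff_decidable by blast
  have P': "P x y \<longleftrightarrow> (\<exists>n. R (pair x y) n)" for x y
    using P[THEN eqset_imp_iff, of "pair x y"] by simp
  have "(\<exists>y. P x y) \<longleftrightarrow> (\<exists>m. R (pair x (pfst m)) (psnd m))" for x
    unfolding P' by (metis fst_conv prod_encode_inverse snd_conv)
  moreover have "decidable (\<lambda>z. R (pair (pfst z) (pfst (psnd z))) (psnd (psnd z)))"
    using decidable_subst[OF R, of "\<lambda>z. pair (pair (pfst z) (pfst (psnd z))) (psnd (psnd z))"]
    by (simp add: computable_intros)
  ultimately show ?thesis
    unfolding ce_iff_decidable
    by (intro exI[of _ "\<lambda>x m. R (pair x (pfst m)) (psnd m)"]) simp
qed

text \<open>Running two programs in sequence would diverge with the first, so the decidable matrices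
  are joined under one common witness.\<close>

lemma ce_disj:
  assumes "ce {x. P x}" "ce {x. Q x}"
  shows "ce {x. P x \<or> Q x}"
proof -
  obtain R S where R: "decidable (\<lambda>z. R (pfst z) (psnd z))" "{x. P x} = {x. \<exists>n. R x n}"
    and S: "decidable (\<lambda>z. S (pfst z) (psnd z))" "{x. Q x} = {x. \<exists>n. S x n}"
    using assms unfolding ce_iff_decidable by blast
  have "decidable (\<lambda>z. \<not> (\<not> R (pfst z) (psnd z) \<and> \<not> S (pfst z) (psnd z)))"
    by (intro decidable_not decidable_conj R S)
  then show ?thesis
    unfolding ce_iff_decidable using R(2) S(2)
    by (intro exI[of _ "\<lambda>x n. R x n \<or> S x n"]) auto
qed

lemma ce_index:
  assumes "ce {z. P (pfst z) (psnd z)}"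
  obtains r where "computable r" "\<And>n. W (r n) = {x. P n x}"
proof -
  obtain f where f: "partial_computable f" and dom: "{z. P (pfst z) (psnd z)} = dom f"
    using assms unfolding ce_iff_dom by blast
  obtain r where r: "computable r" "\<And>n x. \<phi> (r n) x = f (pair n x)"
    using smn[of "\<lambda>n x. f (pair n x)"] f by auto
  have "W (r n) = {x. P n x}" for n
    using dom[THEN eqset_imp_iff, of "pair n _"] by (auto simp: W_def r(2) dom_def)
  with r(1) that show thesis by blast
qed

text \<open>The search is for the least coded pair of a value and its witness, so the value found
  may differ from a given \<open>y\<close>.\<close>

lemma ce_uniformise:
  assumes "ce {z. P (pfst z) (psnd z)}"
  obtains f where "partial_computable f" "\<And>x y. f x = Some y \<Longrightarrow> P x y"
    "\<And>x y. P x y \<Longrightarrow> \<exists>y. f x = Some y"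
proof -
  obtain R where R: "decidable (\<lambda>z. R (pfst z) (psnd z))"
    and P: "{z. P (pfst z) (psnd z)} = {z. \<exists>n. R z n}"
    using assms unfolding ce_iff_decidable by blast
  have P': "P x y \<longleftrightarrow> (\<exists>n. R (pair x y) n)" for x y
    using P[THEN eqset_imp_iff, of "pair x y"] by simp
  let ?Q = "\<lambda>x m. R (pair x (pfst m)) (psnd m)"
  define f where "f x = Option.bind (if \<exists>m. ?Q x m then Some (LEAST m. ?Q x m) else None)
      (\<lambda>m. Some (pfst m))" for x
  have "decidable (\<lambda>z. ?Q (pfst z) (psnd z))"
    using decidable_subst[OF R, of "\<lambda>z. pair (pair (pfst z) (pfst (psnd z))) (psnd (psnd z))"]
    by (simp add: computable_intros)
  then have "partial_computable (\<lambda>x. f x)"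
    unfolding f_def
    by (intro partial_computable_bind partial_computable_Least partial_computable_Some
        computable_intros)
  moreover have "P x y" if "f x = Some y" for x y
    using that LeastI_ex[of "?Q x"] by (auto simp: f_def P' split: if_splits)
  moreover have "\<exists>y. f x = Some y" if xy: "P x y" for x y
  proof -
    obtain n where "R (pair x y) n" using xy P' by blast
    then have "?Q x (pair y n)" by simp
    then have "\<exists>m. ?Q x m" by blast
    then show ?thesis by (simp add: f_def)
  qed
  ultimately show thesis using that by blast
qed

lemma ce_graph:
  assumes f: "partial_computable f" and x: "computable x" and y: "computable y"
  shows "ce {z. f (x z) = Some (y z)}"
proof -
  obtain e where e: "f = \<phi> e" using f unfolding partial_computable_def by blast
  have "{z. f (x z) = Some (y z)} =
      {z. \<exists>n. (step ^^ n) (eval_state e (x z) 0) = return_state (y z) 0}"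
    by (simp add: e phi_eq_Some_iff)
  moreover have "ce \<dots>"
    unfolding eval_state_def return_state_def
    by (intro ce_ex ce_decidable computable_intros computable_funpow[OF computable_step]
        computable_subst[OF x] computable_subst[OF y])
  ultimately show ?thesis by simp
qed

lemma ce_enumeration:
  assumes "ce A" "A \<noteq> {}"
  obtains f where "computable f" "range f = A"
proof -
  obtain a e where a: "a \<in> A" and e: "A = W e"
    using assms unfolding ce_def by blast
  \<comment> \<open>The element \<open>a\<close> is the default while the bounded computation has
    not halted.\<close>
  define f where "f m = (if halts_within e (pfst m) (psnd m) then pfst m else a)" for m
  have "computable (\<lambda>m. f m)"
    unfolding f_def by (intro computable_intros decidable_halts_within)
  moreover have "range f = A"
  proof
    show "range f \<subseteq> A" using a by (auto simp: f_def e mem_W_iff)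
    show "A \<subseteq> range f"
    proof
      fix x assume "x \<in> A"
      then obtain n where "halts_within e x n" unfolding e mem_W_iff by blast
      then have "f (pair x n) = x" by (simp add: f_def)
      then show "x \<in> range f" by (metis rangeI)
    qed
  qed
  ultimately show thesis using that by blast
qed

text \<open>The step function is partial; the invariant \<open>P\<close> keeps it defined along the
  iteration, which makes \<open>F\<close> total.\<close>

lemma computable_iteration:
  assumes g: "partial_computable (\<lambda>z. g (pfst z) (psnd z))"
    and "P a" and step: "\<And>n v. P v \<Longrightarrow> \<exists>w. g n v = Some w \<and> P w"
  obtains F where "computable F" "F 0 = a" "\<And>n. P (F n)" "\<And>n. g n (F n) = Some (F (Suc n))"
proof -
  let ?r = "rec_nat (Some a) (\<lambda>k r. Option.bind r (g k))"
  have ex: "\<exists>v. ?r n = Some v \<and> P v" for n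
  proof (induction n)
    case 0
    then show ?case using \<open>P a\<close> by simp
  next
    case (Suc n)
    then show ?case using step by fastforce
  qed
  define F where "F n = the (?r n)" for n
  have F: "?r n = Some (F n)" "P (F n)" for n
    using ex[of n] by (auto simp: F_def)
  have "computable F"
  proof -
    obtain p where p: "\<And>x. run p x = Some a"
      using computable_const unfolding computable_iff_run by blast
    \<comment> \<open>\<open>PrimRec\<close> also feeds a parameter to its step program. It is
      skipped here, and \<open>0\<close> is put in its place below.\<close>
    have "partial_computable (\<lambda>z. (\<lambda>z. g (pfst z) (psnd z)) (psnd z))"
      by (intro partial_computable_subst[OF g] computable_intros)
    then obtain q where q: "\<And>z. run q z = g (pfst (psnd z)) (psnd (psnd z))"
      unfolding partial_computable_iff_run by (metis (no_types, lifting))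
    have "run (PrimRec p q) = (\<lambda>z. ?r (psnd z))"
      by (simp add: case_prod_beta p q)
    then have "partial_computable (\<lambda>z. ?r (psnd z))"
      unfolding partial_computable_iff_run by blast
    from partial_computable_subst[OF this, of "\<lambda>n. pair 0 n"]
    have "partial_computable (\<lambda>n. ?r n)" by (simp add: computable_intros)
    then show ?thesis by (simp add: F computable_def)
  qed
  moreover have "F 0 = a"
    using F(1)[of 0] by simp
  moreover have "g n (F n) = Some (F (Suc n))" for n
    using F(1)[of "Suc n"] by (simp add: F(1)[of n])
  ultimately show thesis using that F(2) by blast
qed

text \<open>An index \<open>e\<close> of this set would satisfy \<open>e \<in> W e\<close> iff
  \<open>e \<notin> W e\<close>.\<close>

lemma not_ce_diagonal_complement: "\<not> ce {n. n \<notin> W n}"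
  unfolding ce_def by blast

section \<open>Index sets in modular spaces\<close>

locale modular_numbering =
  fixes X :: "'a topology" and \<alpha> :: "nat \<Rightarrow> 'a set" and \<gamma> :: "nat \<Rightarrow> 'a"
    and b :: "nat \<Rightarrow> 'a" and \<O> :: "nat \<Rightarrow> 'a set"
  assumes enumerable: "effectively_enumerable X \<alpha>"
    and t0: "t0_space X"
    and wn: "wn_family (nbhd_indices \<alpha> ` computable_points X \<alpha>)"
    and b: "computable_point_sequence X \<alpha> b"
    and \<O>: "computable_eff_open_sequence \<alpha> \<O>"
    and b_le: "\<And>n y. y \<in> \<O> n \<Longrightarrow> spec_le X (b n) y"
    and basis: "\<And>m. \<alpha> m = (\<Union>i\<in>{i. b i \<in> \<alpha> m}. \<O> i)"
    and principal: "principal_computable_numbering X \<alpha> \<gamma>"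
begin

abbreviation nbhds :: "'a \<Rightarrow> nat set" where "nbhds \<equiv> nbhd_indices \<alpha>"
abbreviation Xc :: "'a set" where "Xc \<equiv> computable_points X \<alpha>"

section \<open>Base, specialisation order and separation of points\<close>

lemma openin_iff: "openin X = arbitrary union_of (\<lambda>U. U \<in> range \<alpha>)"
  using enumerable by (simp add: effectively_enumerable_def)

lemma openin_base: "openin X (\<alpha> n)"
  unfolding openin_iff by (rule union_of_inc) (auto simp: arbitrary_def)

lemma spec_le_nbhds: "spec_le X x y \<Longrightarrow> nbhds x \<subseteq> nbhds y"
  using openin_base by (auto simp: spec_le_def nbhd_indices_def)

text \<open>An open set separating two points is a union of basic sets, one of which already
  separates them.\<close>

lemma nbhds_eqD:
  assumes "x \<in> Xc" "y \<in> Xc" "nbhds x = nbhds y"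
  shows "x = y"
proof (rule ccontr)
  assume "x \<noteq> y"
  then obtain U where U: "openin X U" "x \<in> U \<longleftrightarrow> y \<notin> U"
    using t0 assms(1,2) unfolding t0_space_def computable_points_def by blast
  then obtain B where "B \<subseteq> range \<alpha>" "U = \<Union>B"
    unfolding openin_iff union_of_def by auto
  with U(2) have "\<exists>n. x \<in> \<alpha> n \<longleftrightarrow> y \<notin> \<alpha> n" by blast
  then show False
    using assms(3) by (auto simp: nbhd_indices_def set_eq_iff)
qed

lemma range_\<gamma>: "range \<gamma> = Xc"
  using principal by (simp add: principal_computable_numbering_def computable_numbering_def)

lemma ce_nbhds: "x \<in> Xc \<Longrightarrow> ce (nbhds x)"
  by (simp add: computable_points_def)

lemma b_mem: "b i \<in> Xc"
  using b by (simp add: computable_point_sequence_def)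

text \<open>With \<open>e\<close> enumerating the domain of the \<open>wn\<close>-function and
  \<open>f\<close> reducing the resulting numbering to \<open>\<gamma>\<close>, a number is found by
  locating \<open>n\<close> in the enumeration and applying \<open>f\<close> to its
  position.\<close>

lemma ex_number_of_index:
  obtains \<rho> where "partial_computable \<rho>"
    "\<And>n x. x \<in> Xc \<Longrightarrow> W n = nbhds x \<Longrightarrow> \<exists>k. \<rho> n = Some k \<and> \<gamma> k = x"
proof -
  obtain \<sigma> where \<sigma>: "partial_computable \<sigma>" "\<And>n m. \<sigma> n = Some m \<Longrightarrow> W m \<in> nbhds ` Xc"
    "\<And>n. W n \<in> nbhds ` Xc \<Longrightarrow> \<exists>m. \<sigma> n = Some m \<and> W m = W n"
    using wn unfolding wn_family_def by blast
  have "\<gamma> 0 \<in> Xc" using range_\<gamma> by blast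
  then obtain n0 where "W n0 = nbhds (\<gamma> 0)"
    using ce_nbhds unfolding ce_def by metis
  with \<sigma>(3)[of n0] \<open>\<gamma> 0 \<in> Xc\<close> have "dom \<sigma> \<noteq> {}" by auto
  moreover have "ce (dom \<sigma>)"
    using \<sigma>(1) ce_iff_dom by blast
  ultimately obtain e where e: "computable e" "range e = dom \<sigma>"
    using ce_enumeration by blast
  define s where "s k = the (\<sigma> (e k))" for k
  have s: "\<sigma> (e k) = Some (s k)" for k
  proof -
    have "e k \<in> dom \<sigma>" using e(2) by blast
    then show ?thesis by (auto simp: s_def)
  qed
  have "computable s"
    using partial_computable_subst[OF \<sigma>(1) e(1)] by (simp add: s computable_def)
  have "\<exists>x. x \<in> Xc \<and> nbhds x = W (s k)" for k
    using \<sigma>(2)[OF s] by (metis imageE)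
  then obtain \<xi> where \<xi>: "\<And>k. \<xi> k \<in> Xc" "\<And>k. nbhds (\<xi> k) = W (s k)"
    by metis
  have \<xi>_eq: "\<exists>k. e k = n \<and> \<xi> k = x" if x: "x \<in> Xc" "W n = nbhds x" for n x
  proof -
    obtain m where m: "\<sigma> n = Some m" "W m = W n"
      using \<sigma>(3)[of n] x by auto
    then obtain k where k: "e k = n"
      using e(2) by (metis domI rangeE)
    then have "nbhds (\<xi> k) = nbhds x"
      using \<xi>(2) s[of k] m x(2) by simp
    with k show ?thesis using nbhds_eqD \<xi>(1) x(1) by blast
  qed
  have "range \<xi> = Xc"
  proof
    show "range \<xi> \<subseteq> Xc" using \<xi>(1) by blast
    show "Xc \<subseteq> range \<xi>" using \<xi>_eq ce_nbhds unfolding ce_def by (metis rangeI subsetI)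
  qed
  then have "computable_numbering X \<alpha> \<xi>"
    using \<xi>(2) \<open>computable s\<close> by (auto simp: computable_numbering_def computable_ce_sequence_def)
  then obtain f where f: "computable f" "\<xi> = \<gamma> \<circ> f"
    using principal by (auto simp: principal_computable_numbering_def)
  have "ce {z. e (psnd z) = pfst z}"
    by (intro ce_decidable decidable_eq computable_subst[OF e(1)] computable_intros)
  then obtain t where t: "partial_computable t" "\<And>n k. t n = Some k \<Longrightarrow> e k = n"
    "\<And>n k. e k = n \<Longrightarrow> \<exists>k. t n = Some k"
    by (rule ce_uniformise[of "\<lambda>n k. e k = n"]) blast
  define \<rho> where "\<rho> n = Option.bind (t n) (\<lambda>k. Some (f k))" for n
  have "partial_computable (\<lambda>n. \<rho> n)"
    unfolding \<rho>_def
    by (intro partial_computable_bind t partial_computable_Some computable_subst[OF f(1)]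
        computable_intros)
  moreover have "\<exists>k. \<rho> n = Some k \<and> \<gamma> k = x" if x: "x \<in> Xc" "W n = nbhds x" for n x
  proof -
    obtain k where "t n = Some k"
      using \<xi>_eq[OF x] t(3) by blast
    \<comment> \<open>\<open>t\<close> may find another position than \<open>\<xi>_eq\<close>, but
      every position \<open>k\<close> of \<open>n\<close> has \<open>s k\<close> equal to the value
      of \<open>\<sigma>\<close> at \<open>n\<close>, an index of \<open>nbhds x\<close>.\<close>
    moreover have "\<xi> k = x"
    proof (rule nbhds_eqD)
      obtain m where "\<sigma> n = Some m" "W m = W n"
        using \<sigma>(3)[of n] x by auto
      then show "nbhds (\<xi> k) = nbhds x"
        using \<xi>(2) s[of k] t(2)[OF \<open>t n = Some k\<close>] x(2) by simp
    qed (use x \<xi>(1) in auto)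
    ultimately show ?thesis by (simp add: \<rho>_def f(2))
  qed
  ultimately show thesis using that by blast
qed

text \<open>
  Through a number of the point with neighbourhood indices \<open>{m. P n m}\<close>, the hypotheses make the
  complement of the diagonal halting set computably enumerable.
\<close>

lemma index_set_not_separating:
  assumes K: "ce (Ix \<gamma> K)" and x: "x \<in> K" "x \<in> Xc"
    and P: "ce {z. P (pfst z) (psnd z)}"
    and loop: "\<And>n. n \<notin> W n \<Longrightarrow> {m. P n m} = nbhds x"
    and halt: "\<And>n. n \<in> W n \<Longrightarrow> \<exists>y\<in>Xc. {m. P n m} = nbhds y \<and> y \<notin> K"
  shows False
proof -
  obtain r where r: "computable r" "\<And>n. W (r n) = {m. P n m}"
    using P by (rule ce_index) blast
  obtain \<rho> where \<rho>: "partial_computable \<rho>"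
    "\<And>n x. x \<in> Xc \<Longrightarrow> W n = nbhds x \<Longrightarrow> \<exists>k. \<rho> n = Some k \<and> \<gamma> k = x"
    by (rule ex_number_of_index) blast
  \<comment> \<open>If \<open>n\<close> halts on itself, the number computed from \<open>r n\<close>
    belongs to some \<open>y\<close> outside \<open>K\<close>; otherwise it belongs to
    \<open>x\<close>.\<close>
  have "n \<notin> W n \<longleftrightarrow> (\<exists>k. \<rho> (r n) = Some k \<and> k \<in> Ix \<gamma> K)" for n
  proof (cases "n \<in> W n")
    case True
    then obtain y where "y \<in> Xc" "W (r n) = nbhds y" "y \<notin> K"
      using halt r(2) by metis
    with True show ?thesis using \<rho>(2)[of y "r n"] by (auto simp: Ix_def)
  next
    case False
    then show ?thesis using \<rho>(2)[OF x(2), of "r n"] loop r(2) x(1) by (auto simp: Ix_def)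
  qed
  moreover have "ce {n. \<exists>k. \<rho> (r n) = Some k \<and> k \<in> Ix \<gamma> K}"
    by (intro ce_ex ce_conj ce_graph \<rho>(1) ce_mem K computable_subst[OF r(1)] computable_intros)
  ultimately show False using not_ce_diagonal_complement by simp
qed

lemma index_set_upward_closed:
  assumes K: "ce (Ix \<gamma> K)" and x: "x \<in> K" "x \<in> Xc" and y: "y \<in> Xc" and le: "spec_le X x y"
  shows "y \<in> K"
proof (rule ccontr)
  assume "y \<notin> K"
  have xy: "nbhds x \<subseteq> nbhds y" using le by (rule spec_le_nbhds)
  \<comment> \<open>Since \<open>nbhds x \<subseteq> nbhds y\<close>, adding \<open>nbhds y\<close>
    once \<open>n\<close> halts leaves exactly \<open>nbhds y\<close>.\<close>
  let ?P = "\<lambda>n m. m \<in> nbhds x \<or> m \<in> nbhds y \<and> n \<in> W n"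
  show False
  proof (rule index_set_not_separating[OF K x, of ?P])
    show "ce {z. ?P (pfst z) (psnd z)}"
      by (intro ce_disj ce_conj ce_mem ce_mem_W ce_nbhds x y computable_intros)
  next
    fix n assume "n \<in> W n"
    then show "\<exists>y\<in>Xc. {m. ?P n m} = nbhds y \<and> y \<notin> K"
      using xy y \<open>y \<notin> K\<close> by (intro bexI[of _ y]) auto
  qed auto
qed

text \<open>By contradiction: if no such \<open>i\<close> existed, a chain of approximations
  \<open>b i\<close> of \<open>x\<close>, frozen when a computation halts, would stop outside
  \<open>K\<close>, while the unfrozen chain yields \<open>x\<close> in \<open>K\<close>.\<close>

lemma index_set_compact:
  assumes K: "ce (Ix \<gamma> K)" and x: "x \<in> K" "x \<in> Xc"
  obtains i where "b i \<in> K" "x \<in> \<O> i"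
proof (rule ccontr)
  assume no: "\<not> thesis"
  obtain f where f: "computable f" "\<And>i. \<O> i = (\<Union>n\<in>W (f i). \<alpha> n)"
    using \<O> by (auto simp: computable_eff_open_sequence_def eff_open_set_def)
  obtain c where c: "computable c" "\<And>i. nbhds (b i) = W (c i)"
    using b by (auto simp: computable_point_sequence_def computable_ce_sequence_def)
  obtain g where g: "computable g" "\<And>i j. \<alpha> i \<inter> \<alpha> j = (\<Union>n. \<alpha> (g (pair i (pair j n))))"
    using enumerable by (auto simp: effectively_enumerable_def)
  define D where "D = {i. x \<in> \<O> i}"
  have below: "nbhds (b i) \<subseteq> nbhds x" if "i \<in> D" for i
    using that b_le spec_le_nbhds by (simp add: D_def)
  \<comment> \<open>The \<open>basis\<close> equation at \<open>m\<close> supplies an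
    \<open>i\<close> with \<open>b i \<in> \<alpha> m\<close> and
    \<open>x \<in> \<O> i\<close>.\<close>
  have cofinal: "\<exists>i\<in>D. m \<in> nbhds (b i)" if "m \<in> nbhds x" for m
    using that basis[of m] by (auto simp: D_def nbhd_indices_def)
  have "D = {i. \<exists>p. p \<in> W (f i) \<and> p \<in> nbhds x}"
    by (auto simp: D_def f(2) nbhd_indices_def)
  moreover have "ce \<dots>"
    by (intro ce_ex ce_conj ce_mem ce_mem_W ce_nbhds x computable_subst[OF f(1)] computable_intros)
  ultimately have "ce D" by simp
  have "x \<in> topspace X" using x(2) by (simp add: computable_points_def)
  then obtain m where "x \<in> \<alpha> m"
    using openin_topspace[of X] unfolding openin_iff union_of_def by fast
  then have "D \<noteq> {}"
    using cofinal[of m] by (auto simp: nbhd_indices_def)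
  with \<open>ce D\<close> obtain d where d: "computable d" "range d = D"
    using ce_enumeration by blast

  text \<open>
    The last conjunct puts \<open>b k\<close> above both \<open>b i\<close> and \<open>b j\<close> in an enumerable way: it says that
    \<open>b k\<close> lies in a basic open subset of \<open>\<O> i \<inter> \<O> j\<close>.
  \<close>
  define Q where "Q i j k \<longleftrightarrow> k \<in> D \<and>
      (\<exists>p q n. p \<in> W (f i) \<and> q \<in> W (f j) \<and> g (pair p (pair q n)) \<in> W (c k))" for i j k
  have Q_above: "nbhds (b i) \<subseteq> nbhds (b k) \<and> nbhds (b j) \<subseteq> nbhds (b k)" if Q: "Q i j k" for i j k
  proof -
    obtain p q n where pq: "p \<in> W (f i)" "q \<in> W (f j)" and "g (pair p (pair q n)) \<in> nbhds (b k)"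
      using Q unfolding Q_def c(2) by blast
    then have "b k \<in> \<alpha> p \<inter> \<alpha> q"
      unfolding g(2) by (auto simp: nbhd_indices_def)
    with pq have "b k \<in> \<O> i" "b k \<in> \<O> j"
      by (auto simp: f(2))
    then show ?thesis using b_le spec_le_nbhds by blast
  qed
  have Q_ex: "\<exists>k. Q i j k" if ij: "i \<in> D" "j \<in> D" for i j
  proof -
    obtain p q where pq: "p \<in> W (f i)" "q \<in> W (f j)" "x \<in> \<alpha> p \<inter> \<alpha> q"
      using ij by (auto simp: D_def f(2))
    then obtain n where "g (pair p (pair q n)) \<in> nbhds x"
      unfolding g(2) by (auto simp: nbhd_indices_def)
    \<comment> \<open>\<open>cofinal\<close> places some \<open>b k\<close> with
      \<open>k \<in> D\<close> in this basic neighbourhood of \<open>x\<close>.\<close>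
    with cofinal pq show ?thesis unfolding Q_def c(2) by blast
  qed
  \<comment> \<open>The inner pair holds the stage and the current index of the chain; the outer
    second component is the next index.\<close>
  have "ce {z. Q (d (pfst (pfst z))) (psnd (pfst z)) (psnd z)}"
    unfolding Q_def
    by (intro ce_ex ce_conj ce_mem[OF \<open>ce D\<close>] ce_mem_W computable_subst[OF d(1)]
        computable_subst[OF f(1)] computable_subst[OF g(1)] computable_subst[OF c(1)]
        computable_intros)
  then obtain u where u: "partial_computable u"
    "\<And>z k. u z = Some k \<Longrightarrow> Q (d (pfst z)) (psnd z) k"
    "\<And>z k. Q (d (pfst z)) (psnd z) k \<Longrightarrow> \<exists>k. u z = Some k"
    by (rule ce_uniformise) blast
  \<comment> \<open>Stage \<open>n\<close> moves to an index above both \<open>F n\<close> and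
    \<open>d n\<close>, so the chain increases and overtakes every member of
    \<open>D\<close>.\<close>
  obtain F where F: "computable F" "\<And>n. F n \<in> D" "\<And>n. u (pair n (F n)) = Some (F (Suc n))"
  proof (rule computable_iteration[of "\<lambda>n v. u (pair n v)" "\<lambda>v. v \<in> D" "d 0"])
    show "\<exists>w. u (pair n v) = Some w \<and> w \<in> D" if "v \<in> D" for n v
    proof -
      have "d n \<in> D" using d(2) by blast
      then obtain w where w: "u (pair n v) = Some w"
        using Q_ex[of "d n" v] u(3)[of "pair n v"] \<open>v \<in> D\<close> by auto
      with u(2)[OF w] show ?thesis by (auto simp: Q_def)
    qed
  qed (use u(1) d(2) in auto)
  have above: "nbhds (b (d n)) \<subseteq> nbhds (b (F (Suc n)))" "nbhds (b (F n)) \<subseteq> nbhds (b (F (Suc n)))" for n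
    using Q_above[OF u(2)[OF F(3)[of n]]] by auto
  then have mono: "nbhds (b (F m)) \<subseteq> nbhds (b (F n))" if "m \<le> n" for m n
    using lift_Suc_mono_le[of "\<lambda>n. nbhds (b (F n))"] that by blast
  \<comment> \<open>Stage \<open>s\<close> contributes only if \<open>n\<close> has not halted on
    itself within \<open>s\<close> steps.\<close>
  let ?P = "\<lambda>n m. \<exists>s. \<not> halts_within n n s \<and> m \<in> W (c (F s))"
  show False
  proof (rule index_set_not_separating[OF K x, of ?P])
    show "ce {z. ?P (pfst z) (psnd z)}"
      by (intro ce_ex ce_conj ce_mem_W ce_decidable decidable_not decidable_halts_within
          computable_subst[OF c(1)] computable_subst[OF F(1)] computable_intros)
  next
    fix n assume "n \<notin> W n"
    then have "{m. ?P n m} = (\<Union>s. nbhds (b (F s)))"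
      unfolding c(2) mem_W_iff[of n] by blast
    also have "\<dots> = nbhds x"
    proof
      show "(\<Union>s. nbhds (b (F s))) \<subseteq> nbhds x" using below F(2) by blast
      show "nbhds x \<subseteq> (\<Union>s. nbhds (b (F s)))"
      proof
        fix m assume "m \<in> nbhds x"
        then obtain i where "i \<in> D" "m \<in> nbhds (b i)" using cofinal by blast
        moreover from \<open>i \<in> D\<close> obtain n where "i = d n" using d(2) by blast
        ultimately show "m \<in> (\<Union>s. nbhds (b (F s)))" using above(1) by blast
      qed
    qed
    finally show "{m. ?P n m} = nbhds x" .
  next
    fix n assume "n \<in> W n"
    then obtain s where "halts_within n n s" by (auto simp: mem_W_iff)
    \<comment> \<open>Nothing halts within \<open>0\<close> steps, so there is a last contributing
      stage \<open>t\<close>; by monotonicity \<open>b (F t)\<close> determines the whole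
      set.\<close>
    then obtain t where t: "\<not> halts_within n n t" "halts_within n n (Suc t)"
      using ex_least_nat_less[of "halts_within n n" s] halts_within_0 by auto
    then have "\<not> halts_within n n s \<longleftrightarrow> s \<le> t" for s
      using halts_within_mono by (metis not_less_eq_eq)
    then have "{m. ?P n m} = nbhds (b (F t))"
      using mono by (auto simp: c(2)[symmetric])
    moreover have "b (F t) \<notin> K"
      using no that F(2)[of t] by (auto simp: D_def)
    ultimately show "\<exists>y\<in>Xc. {m. ?P n m} = nbhds y \<and> y \<notin> K"
      using b_mem by blast
  qed
qed

section \<open>Index sets and effectively open sets\<close>

lemma index_set_eq_Union:
  assumes "K \<subseteq> Xc" "ce (Ix \<gamma> K)"
  shows "K = (\<Union>i\<in>{i. b i \<in> K}. \<O> i) \<inter> Xc"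
proof
  show "K \<subseteq> (\<Union>i\<in>{i. b i \<in> K}. \<O> i) \<inter> Xc"
    using index_set_compact[OF assms(2)] assms(1) by blast
  show "(\<Union>i\<in>{i. b i \<in> K}. \<O> i) \<inter> Xc \<subseteq> K"
    using index_set_upward_closed[OF assms(2)] b_mem b_le by blast
qed

text \<open>A computable numbering turns membership of \<open>\<gamma> n\<close> in a basic set into
  membership in a c.e. set with index computable from \<open>n\<close>.\<close>

lemma ce_index_set_of_eff_open: "ce (Ix \<gamma> (Xc \<inter> eff_open_set \<alpha> i))"
proof -
  obtain f where f: "computable f" "\<And>n. nbhds (\<gamma> n) = W (f n)"
    using principal by (auto simp: principal_computable_numbering_def computable_numbering_def
        computable_ce_sequence_def)
  have "Ix \<gamma> (Xc \<inter> eff_open_set \<alpha> i) = {n. \<exists>m. m \<in> W i \<and> m \<in> W (f n)}"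
    using range_\<gamma> by (auto simp: Ix_def eff_open_set_def f(2)[symmetric] nbhd_indices_def)
  moreover have "ce \<dots>"
    by (intro ce_ex ce_conj ce_mem_W computable_subst[OF f(1)] computable_intros)
  ultimately show ?thesis by simp
qed

lemma ex_uniform_eff_open_index:
  obtains h where "computable h"
    "\<And>K e. K \<subseteq> Xc \<Longrightarrow> W e = Ix \<gamma> K \<Longrightarrow> K = eff_open_set \<alpha> (h e) \<inter> Xc"
proof -
  obtain f where f: "computable f" "\<And>i. \<O> i = eff_open_set \<alpha> (f i)"
    using \<O> by (auto simp: computable_eff_open_sequence_def)
  obtain c where c: "computable c" "\<And>i. nbhds (b i) = W (c i)"
    using b by (auto simp: computable_point_sequence_def computable_ce_sequence_def)
  obtain \<rho> where \<rho>: "partial_computable \<rho>"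
    "\<And>n x. x \<in> Xc \<Longrightarrow> W n = nbhds x \<Longrightarrow> \<exists>k. \<rho> n = Some k \<and> \<gamma> k = x"
    by (rule ex_number_of_index) blast
  \<comment> \<open>For an index \<open>e\<close> of \<open>Ix \<gamma> K\<close>, the first two
    conjuncts express \<open>b i \<in> K\<close>, since \<open>\<rho> (c i)\<close> is a number of
    \<open>b i\<close>.\<close>
  let ?P = "\<lambda>e m. \<exists>i k. \<rho> (c i) = Some k \<and> k \<in> W e \<and> m \<in> W (f i)"
  have "ce {z. ?P (pfst z) (psnd z)}"
    by (intro ce_ex ce_conj ce_mem_W ce_graph \<rho>(1) computable_subst[OF c(1)]
        computable_subst[OF f(1)] computable_intros)
  then obtain h where h: "computable h" "\<And>e. W (h e) = {m. ?P e m}"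
    by (rule ce_index) blast
  have "K = eff_open_set \<alpha> (h e) \<inter> Xc" if K: "K \<subseteq> Xc" "W e = Ix \<gamma> K" for K e
  proof -
    have "b i \<in> K \<longleftrightarrow> (\<exists>k. \<rho> (c i) = Some k \<and> k \<in> W e)" for i
      using \<rho>(2)[OF b_mem c(2)[symmetric], of i] K(2) by (auto simp: Ix_def)
    then have "W (h e) = (\<Union>i\<in>{i. b i \<in> K}. W (f i))"
      unfolding h(2) by blast
    then have "eff_open_set \<alpha> (h e) = (\<Union>i\<in>{i. b i \<in> K}. \<O> i)"
      unfolding f(2) eff_open_set_def by blast
    moreover have "ce (Ix \<gamma> K)"
      using K(2) unfolding ce_def by metis
    ultimately show ?thesis using index_set_eq_Union[OF K(1)] by simp
  qed
  with h(1) that show thesis by blast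
qed

end

theorem theorem2p5:
  fixes X :: "'a topology" and \<alpha> :: "nat \<Rightarrow> 'a set" and \<gamma> :: "nat \<Rightarrow> 'a"
  assumes "modular_T0_space X \<alpha>"
    and "principal_computable_numbering X \<alpha> \<gamma>"
  shows "(\<forall>K \<subseteq> computable_points X \<alpha>.
            ce (Ix \<gamma> K) \<longleftrightarrow> (\<exists>i. K = computable_points X \<alpha> \<inter> eff_open_set \<alpha> i)) \<and>
         (\<exists>h. computable h \<and>
            (\<forall>K \<subseteq> computable_points X \<alpha>. \<forall>e. W e = Ix \<gamma> K \<longrightarrow>
               K = eff_open_set \<alpha> (h e) \<inter> computable_points X \<alpha>))"
proof -
  obtain b \<O> where "modular_numbering X \<alpha> \<gamma> b \<O>"
    using assms unfolding modular_T0_space_def modular_numbering_def by blast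
  then interpret modular_numbering X \<alpha> \<gamma> b \<O> .
  obtain h where h: "computable h"
    "\<And>K e. K \<subseteq> Xc \<Longrightarrow> W e = Ix \<gamma> K \<Longrightarrow> K = eff_open_set \<alpha> (h e) \<inter> Xc"
    by (rule ex_uniform_eff_open_index) blast
  \<comment> \<open>The uniform version already contains this one: \<open>h\<close> is applied to
    any index of \<open>Ix \<gamma> K\<close>.\<close>
  have "\<exists>i. K = Xc \<inter> eff_open_set \<alpha> i" if K: "K \<subseteq> Xc" "ce (Ix \<gamma> K)" for K
    using h(2)[OF K(1)] K(2) unfolding ce_def by (metis Int_commute)
  with h ce_index_set_of_eff_open show ?thesis by blast
qed

end
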